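(* Let $n\ge 1$, $p=(p_1,p_2)\in\mathbb{R}^2$, let $B=(B_1,B_2)$ be a pair of commuting real $n\times n$ matrices, and suppose that the matrices $M_k=\mathrm{diag}(p_k,B_k,0)\in M_{n+2}(\mathbb{R})$ ($k=1,2$) satisfy (M1) $M_1,M_2$ are linearly independent, and (M2) no nonzero element of $\mathrm{span}(M_1,M_2)$ is similar to a skew-symmetric matrix. Then, as topological groups, $$G_{p,B}\;\cong\; M\rtimes E_{p,B}\;\cong\;\mathbb{R}^{n+1}\rtimes H_{p,B}.$$ Here $M\rtimes E_{p,B}$ is identified with the closed subgroup $$K_{p,B}=\left\{\begin{bmatrix} a & 0\\ m a & (a^{-1})^{T}\end{bmatrix} : m\in M,\ a\in E_{p,B}\right\}$$ of the symplectic group $Sp(n+1,\mathbb{R})$, and $\mathbb{R}^{n+1}\rtimes H_{p,B}$ is a closed subgroup of the affine group $\mathit{Aff}(n+1,\mathbb{R})$. In particular, $G_{p,B}$ is isomorphic to a closed subgroup of $Sp(n+1,\mathbb{R})$ and to a closed subgroup of $\mathit{Aff}(n+1,\mathbb{R})$.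
   Context: For $t=(t_1,t_2)^T\in\mathbb{R}^2$ write $pt=p_1t_1+p_2t_2$ and $Bt=B_1t_1+B_2t_2$. The group $G_{p,B}$ is the set of all $g(t,x,y,z)$ with $t\in\mathbb{R}^2$, $x,y\in\mathbb{R}^n$, $z\in\mathbb{R}$ (topology of $\mathbb{R}^{2n+3}$), with group law $$g(t,x,y,z)\,g(\tilde t,\tilde x,\tilde y,\tilde z)=g\bigl(t+\tilde t,\;x+e^{Bt}\tilde x,\;y+e^{pt}[e^{-Bt}]^{T}\tilde y,\;z+e^{pt}\tilde z+y^{T}e^{Bt}\tilde x\bigr);$$ it is a semidirect product $\mathbb{H}^n_{pol}\rtimes\mathbb{R}^2$ of the polarized Heisenberg group with $\mathbb{R}^2$. $M$ is the $(n+1)$-dimensional space of symmetric matrices $$M=\left\{m(z,x)=\begin{bmatrix}-z&-x^T\\ -x&0\end{bmatrix}: x\in\mathbb{R}^n,\ z\in\mathbb{R}\right\},$$ and $E_{p,B}$ is the subgroup of $GL_{n+1}(\mathbb{R})$ $$E_{p,B}=\left\{a(t,y)=\begin{bmatrix}1&0\\ -\tfrac12 y&I_n\end{bmatrix}\begin{bmatrix}e^{-pt/2}&0\\ 0&e^{pt/2}[e^{-Bt}]^{T}\end{bmatrix}: t\in\mathbb{R}^2,\ y\in\mathbb{R}^n\right\}.$$ The semidirect product $M\rtimes E_{p,B}$ is formed with respect to the action $\alpha_a(m)=(a^{-1})^{T}m\,a^{-1}$ of $E_{p,B}$ on $M$, i.e. $(m,a)(\tilde m,\tilde a)=(m+\alpha_a(\tilde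 m),a\tilde a)$. $$H_{p,B}=\left\{h_{a(t,y)}=\begin{bmatrix}e^{pt}&y^{T}e^{Bt}\\ 0&e^{Bt}\end{bmatrix}: t\in\mathbb{R}^2,\ y\in\mathbb{R}^n\right\}\subset GL_{n+1}(\mathbb{R}).$$ The affine group is $\mathit{Aff}(n+1,\mathbb{R})=\mathbb{R}^{n+1}\rtimes GL_{n+1}(\mathbb{R})$ with law $(x,a)(\tilde x,\tilde a)=(x+a\tilde x,a\tilde a)$, and $\mathbb{R}^{n+1}\rtimes H_{p,B}$ is its subgroup of pairs $(x,h)$ with $h\in H_{p,B}$. $Sp(n+1,\mathbb{R})$ is the group of $\mathcal{A}\in GL_{2n+2}(\mathbb{R})$ with $\mathcal{A}^T\mathcal{J}\mathcal{A}=\mathcal{J}$, where $\mathcal{J}=\begin{bmatrix}0&-I_{n+1}\\ I_{n+1}&0\end{bmatrix}$. *)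

theory Defs
  imports "HOL-Analysis.Analysis" "HOL-Algebra.Group"
begin

definition topological_group :: "('a, 'b) monoid_scheme \<Rightarrow> 'a topology \<Rightarrow> bool" where
  "topological_group G T \<longleftrightarrow>
     group G \<and> topspace T = carrier G \<and>
     continuous_map (prod_topology T T) T (\<lambda>(x, y). x \<otimes>\<^bsub>G\<^esub> y) \<and>
     continuous_map T T (\<lambda>x. inv\<^bsub>G\<^esub> x)"

definition topgroup_isomorphism ::
  "('a, 'c) monoid_scheme \<Rightarrow> 'a topology \<Rightarrow> ('b, 'd) monoid_scheme \<Rightarrow> 'b topology \<Rightarrow> ('a \<Rightarrow> 'b) \<Rightarrow> bool"
where
  "topgroup_isomorphism G S H T f \<longleftrightarrow>
     topological_group G S \<and> topological_group H T \<and> f \<in> iso G H \<and> homeomorphic_map S T f"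

definition topgroup_isomorphic ::
  "('a, 'c) monoid_scheme \<Rightarrow> 'a topology \<Rightarrow> ('b, 'd) monoid_scheme \<Rightarrow> 'b topology \<Rightarrow> bool"
where
  "topgroup_isomorphic G S H T \<longleftrightarrow> (\<exists>f. topgroup_isomorphism G S H T f)"

definition closed_subgroup :: "'a set \<Rightarrow> ('a, 'b) monoid_scheme \<Rightarrow> 'a topology \<Rightarrow> bool" where
  "closed_subgroup K G T \<longleftrightarrow> topological_group G T \<and> subgroup K G \<and> closedin T K"

definition restrict_group :: "('a, 'b) monoid_scheme \<Rightarrow> 'a set \<Rightarrow> ('a, 'b) monoid_scheme" where
  "restrict_group G K = G\<lparr>carrier := K\<rparr>"

definition semidirect ::
  "('a, 'c) monoid_scheme \<Rightarrow> ('b, 'd) monoid_scheme \<Rightarrow> ('b \<Rightarrow> 'a \<Rightarrow> 'a) \<Rightarrow> ('a \<times> 'b) monoid"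
where
  "semidirect N H \<alpha> =
     \<lparr>carrier = carrier N \<times> carrier H,
      mult = (\<lambda>(m, a) (m', a'). (m \<otimes>\<^bsub>N\<^esub> \<alpha> a m', a \<otimes>\<^bsub>H\<^esub> a')),
      one = (\<one>\<^bsub>N\<^esub>, \<one>\<^bsub>H\<^esub>)\<rparr>"

definition additive_group :: "'a::ab_group_add set \<Rightarrow> 'a monoid" where
  "additive_group V = \<lparr>carrier = V, mult = (+), one = 0\<rparr>"

text \<open>
  The product and the powers that the library's type class instances put on real vectors and
  matrices are componentwise, hence the exponential series is formed with the matrix product.
\<close>

definition matpow :: "real^'n^'n \<Rightarrow> nat \<Rightarrow> real^'n^'n" where
  "matpow A k = ((\<lambda>X. A ** X) ^^ k) (mat 1)"

definition matexp :: "real^'n^'n \<Rightarrow> real^'n^'n" where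
  "matexp A = (\<Sum>k. (1 / fact k) *\<^sub>R matpow A k)"

text \<open>
  Block matrices are indexed by sum types. The index type \<open>1 + 'n\<close> plays the role of
  \<open>{1, \<dots>, n + 1}\<close>, with the element of the one-point type \<open>1\<close> coming first.
\<close>

definition block :: "real^'c^'a \<Rightarrow> real^'d^'a \<Rightarrow> real^'c^'b \<Rightarrow> real^'d^'b \<Rightarrow> real^('c::finite + 'd::finite)^('a::finite + 'b::finite)"
where
  "block P Q R S =
     (\<chi> i j. case i of
        Inl a \<Rightarrow> (case j of Inl c \<Rightarrow> P $ a $ c | Inr d \<Rightarrow> Q $ a $ d)
      | Inr b \<Rightarrow> (case j of Inl c \<Rightarrow> R $ b $ c | Inr d \<Rightarrow> S $ b $ d))"

definition similar_matrix :: "real^'n^'n \<Rightarrow> real^'n^'n \<Rightarrow> bool" where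
  "similar_matrix X Y \<longleftrightarrow> (\<exists>P. invertible P \<and> X = P ** Y ** matrix_inv P)"

definition skew_symmetric :: "real^'n^'n \<Rightarrow> bool" where
  "skew_symmetric X \<longleftrightarrow> transpose X = - X"

definition GL_group :: "(real^'n^'n) monoid" where
  "GL_group = \<lparr>carrier = {A. invertible A}, mult = (**), one = mat 1\<rparr>"

definition sympl_J :: "real^('m::finite + 'm)^('m + 'm)" where
  "sympl_J = block 0 (- mat 1) (mat 1) 0"

definition Sp_group :: "(real^('m::finite + 'm)^('m + 'm)) monoid" where
  "Sp_group = restrict_group GL_group {A. invertible A \<and> transpose A ** sympl_J ** A = sympl_J}"

abbreviation Sp_top :: "(real^('m::finite + 'm)^('m + 'm)) topology" where
  "Sp_top \<equiv> top_of_set (carrier Sp_group)"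

definition Aff_group :: "((real^'m) \<times> (real^'m^'m)) monoid" where
  "Aff_group = semidirect (additive_group UNIV) GL_group (*v)"

abbreviation Aff_top :: "((real^'m) \<times> (real^'m^'m)) topology" where
  "Aff_top \<equiv> top_of_set (carrier Aff_group)"

definition pt :: "real^2 \<Rightarrow> real^2 \<Rightarrow> real" where
  "pt p t = p $ 1 * t $ 1 + p $ 2 * t $ 2"

definition Bt :: "(real^'n^'n)^2 \<Rightarrow> real^2 \<Rightarrow> real^'n^'n" where
  "Bt B t = t $ 1 *\<^sub>R B $ 1 + t $ 2 *\<^sub>R B $ 2"

definition Mk :: "real^2 \<Rightarrow> (real^'n^'n)^2 \<Rightarrow> 2 \<Rightarrow> real^(1 + ('n::finite + 1))^(1 + ('n + 1))" where
  "Mk p B k = block (mat (p $ k)) 0 0 (block (B $ k) 0 0 (0 :: real^1^1))"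

definition G_group ::
  "real^2 \<Rightarrow> (real^'n^'n)^2 \<Rightarrow> ((real^2) \<times> (real^'n) \<times> (real^'n) \<times> real) monoid"
where
  "G_group p B =
     \<lparr>carrier = UNIV,
      mult = (\<lambda>(t, x, y, z) (t', x', y', z').
        (t + t',
         x + matexp (Bt B t) *v x',
         y + (exp (pt p t) *\<^sub>R transpose (matexp (- Bt B t))) *v y',
         z + exp (pt p t) * z' + y \<bullet> (matexp (Bt B t) *v x'))),
      one = (0, 0, 0, 0)\<rparr>"

abbreviation G_top :: "((real^2) \<times> (real^'n) \<times> (real^'n) \<times> real) topology" where
  "G_top \<equiv> euclidean"

definition m_mat :: "real \<Rightarrow> real^'n \<Rightarrow> real^(1 + 'n::finite)^(1 + 'n)" where
  "m_mat z x = block (mat (- z)) (- rowvector x) (- columnvector x) 0"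

definition M_set :: "(real^(1 + 'n::finite)^(1 + 'n)) set" where
  "M_set = {m_mat z x | z x. True}"

definition a_mat :: "real^2 \<Rightarrow> (real^'n^'n)^2 \<Rightarrow> real^2 \<Rightarrow> real^'n \<Rightarrow> real^(1 + 'n::finite)^(1 + 'n)" where
  "a_mat p B t y =
     block (mat 1) 0 (columnvector (- (1 / 2) *\<^sub>R y)) (mat 1) **
     block (mat (exp (- pt p t / 2))) 0 0 (exp (pt p t / 2) *\<^sub>R transpose (matexp (- Bt B t)))"

definition E_set :: "real^2 \<Rightarrow> (real^'n^'n)^2 \<Rightarrow> (real^(1 + 'n::finite)^(1 + 'n)) set" where
  "E_set p B = {a_mat p B t y | t y. True}"

definition M_action :: "real^'m^'m \<Rightarrow> real^'m^'m \<Rightarrow> real^'m^'m" where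
  "M_action a m = transpose (matrix_inv a) ** m ** matrix_inv a"

definition ME_group ::
  "real^2 \<Rightarrow> (real^'n^'n)^2 \<Rightarrow> ((real^(1 + 'n::finite)^(1 + 'n)) \<times> (real^(1 + 'n::finite)^(1 + 'n))) monoid"
where
  "ME_group p B =
     semidirect (additive_group M_set) (restrict_group GL_group (E_set p B)) M_action"

abbreviation ME_top ::
  "real^2 \<Rightarrow> (real^'n^'n)^2 \<Rightarrow> ((real^(1 + 'n::finite)^(1 + 'n)) \<times> (real^(1 + 'n::finite)^(1 + 'n))) topology"
where
  "ME_top p B \<equiv> prod_topology (top_of_set M_set) (top_of_set (E_set p B))"

definition K_mat :: "real^'m^'m \<Rightarrow> real^'m^'m \<Rightarrow> real^('m::finite + 'm)^('m + 'm)" where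
  "K_mat m a = block a 0 (m ** a) (transpose (matrix_inv a))"

definition K_set ::
  "real^2 \<Rightarrow> (real^'n^'n)^2 \<Rightarrow> (real^((1 + 'n::finite) + (1 + 'n))^((1 + 'n) + (1 + 'n))) set"
where
  "K_set p B = {K_mat m a | m a. m \<in> M_set \<and> a \<in> E_set p B}"

definition h_mat :: "real^2 \<Rightarrow> (real^'n^'n)^2 \<Rightarrow> real^2 \<Rightarrow> real^'n \<Rightarrow> real^(1 + 'n::finite)^(1 + 'n)" where
  "h_mat p B t y =
     block (mat (exp (pt p t))) (rowvector y ** matexp (Bt B t)) 0 (matexp (Bt B t))"

definition H_set :: "real^2 \<Rightarrow> (real^'n^'n)^2 \<Rightarrow> (real^(1 + 'n::finite)^(1 + 'n)) set" where
  "H_set p B = {h_mat p B t y | t y. True}"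

definition RH_set ::
  "real^2 \<Rightarrow> (real^'n^'n)^2 \<Rightarrow> ((real^(1 + 'n::finite)) \<times> (real^(1 + 'n::finite)^(1 + 'n))) set"
where
  "RH_set p B = UNIV \<times> H_set p B"

end

theory Submission
  imports Defs
begin

text \<open>
  Write \<open>e(t)\<close> for \<open>matexp (Bt B t)\<close>. The maps
  \<open>(t, x, y, z) \<mapsto> (m(z, x), a(t, y))\<close> and \<open>(t, x, y, z) \<mapsto> ((z, x), h(t, y))\<close> respect products: the
  matrices \<open>a(t, y)\<close> and \<open>h(t, y)\<close> multiply as \<open>(t, y)\<close> does in \<open>G\<close> (\<open>a_mat_mult\<close>, \<open>h_mat_mult\<close>), and both
  the action of \<open>a(t, y)\<close> on \<open>M\<close> (\<open>M_action_a_mat\<close>) and the product of \<open>h(t, y)\<close> with the vector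
  \<open>(z, x)\<close> yield \<open>(exp (pt p t) * z + y \<bullet> e(t) x, e(t) x)\<close>. This is plain block matrix computation and
  uses only that the two matrices of \<open>B\<close> commute.

  What needs the hypotheses (M1) and (M2) is that these maps are injective, and homeomorphisms onto
  closed sets. It suffices that \<open>t \<mapsto> (exp (pt p t), e(t))\<close> is injective and proper: if \<open>pt p t\<close>,
  \<open>e(t)\<close> and \<open>e(- t)\<close> stay bounded along a sequence, so does \<open>t\<close> (\<open>matexp_Bt_proper\<close>). The argument
  avoids eigenvalues. Suppose \<open>t k\<close> tends to infinity in the direction \<open>u\<close> with these quantities bounded.
  After passing to a subsequence, \<open>e(t k - t N)\<close> is close to the identity and so equals \<open>matexp (X k)\<close>
  with \<open>X k\<close> bounded and in the bicommutant of \<open>B\<close> (\<open>matexp_log_exists\<close>). Then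
  \<open>Y k = Bt B (t k - t N) - X k\<close> has exponential \<open>1\<close>, hence generates a periodic, bounded one-parameter
  group. In a commutative algebra of matrices the generators of bounded one-parameter groups form a linear
  subspace (\<open>subspace_bounded_matexp\<close>), which is closed; so the limit \<open>Bt B u\<close> of \<open>Y k / norm (t k)\<close>
  generates a bounded group too (\<open>bounded_matexp_limit_direction\<close>), and \<open>pt p u = 0\<close>.

  The generator of a bounded one-parameter group is similar to a skew-symmetric matrix
  (\<open>bounded_matexp_imp_similar_skew\<close>): averaging over the group gives an invariant inner product, and an
  orthonormal basis for it provides the conjugation. Hence \<open>diag(pt p u, Bt B u, 0)\<close>, which is nonzero by
  (M1), contradicts (M2).
\<close>

section \<open>Square matrices as a Banach algebra\<close>

text \<open>
  A copy of the type of square matrices whose multiplication is the matrix product and whose norm is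
  the operator norm of the Euclidean norm. Being an instance of the Banach algebra classes, it makes
  the general theory of \<open>exp\<close> applicable to matrices; its results are transferred to \<open>matexp\<close>.
\<close>

typedef 'n sqmat = "UNIV :: (real^'n^'n) set"
  morphisms mat_of sq_of by simp

setup_lifting type_definition_sqmat

instantiation sqmat :: (finite) real_algebra_1
begin
lift_definition zero_sqmat :: "'a sqmat" is 0 .
lift_definition one_sqmat :: "'a sqmat" is "mat 1" .
lift_definition plus_sqmat :: "'a sqmat \<Rightarrow> 'a sqmat \<Rightarrow> 'a sqmat" is "(+)" .
lift_definition minus_sqmat :: "'a sqmat \<Rightarrow> 'a sqmat \<Rightarrow> 'a sqmat" is "(-)" .
lift_definition uminus_sqmat :: "'a sqmat \<Rightarrow> 'a sqmat" is uminus .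
lift_definition times_sqmat :: "'a sqmat \<Rightarrow> 'a sqmat \<Rightarrow> 'a sqmat" is "(**)" .
lift_definition scaleR_sqmat :: "real \<Rightarrow> 'a sqmat \<Rightarrow> 'a sqmat" is scaleR .
instance
proof
  fix a b c :: "'a sqmat" and r s :: real
  show "a * b * c = a * (b * c)" by transfer (simp add: matrix_mul_assoc)
  show "(a + b) * c = a * c + b * c"
    by transfer (simp add: vec_eq_iff matrix_matrix_mult_def sum.distrib distrib_right)
  show "a * (b + c) = a * b + a * c" by transfer (simp add: matrix_add_ldistrib)
  show "r *\<^sub>R a * b = r *\<^sub>R (a * b)" 
    by transfer (simp add: vec_eq_iff matrix_matrix_mult_def sum_distrib_left mult.assoc)
  show "a * r *\<^sub>R b = r *\<^sub>R (a * b)" 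
    by transfer (simp add: vec_eq_iff matrix_matrix_mult_def sum_distrib_left mult_ac)
  show "(0::'a sqmat) \<noteq> 1"
    by transfer (auto simp: vec_eq_iff mat_def)
qed (transfer; simp add: algebra_simps)+
end

instantiation sqmat :: (finite) real_normed_algebra_1
begin
lift_definition norm_sqmat :: "'a sqmat \<Rightarrow> real" is "\<lambda>A. onorm ((*v) A)" .
definition dist_sqmat :: "'a sqmat \<Rightarrow> 'a sqmat \<Rightarrow> real" where "dist_sqmat a b = norm (a - b)"
definition sgn_sqmat :: "'a sqmat \<Rightarrow> 'a sqmat" where "sgn_sqmat a = a /\<^sub>R norm a"
definition uniformity_sqmat :: "('a sqmat \<times> 'a sqmat) filter"
  where "uniformity_sqmat = (INF e\<in>{0<..}. principal {(x, y). dist x y < e})"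
definition open_sqmat :: "'a sqmat set \<Rightarrow> bool"
  where "open_sqmat U \<longleftrightarrow> (\<forall>x\<in>U. eventually (\<lambda>(x', y). x' = x \<longrightarrow> y \<in> U) uniformity)"
instance
proof
  fix a b :: "'a sqmat" and r :: real
  show "norm a = 0 \<longleftrightarrow> a = 0"
    by transfer (simp add: onorm_eq_0 matrix_eq)
  show "norm (a + b) \<le> norm a + norm b"
    using onorm_triangle[of "(*v) (mat_of a)" "(*v) (mat_of b)"]
    by (simp add: norm_sqmat.rep_eq plus_sqmat.rep_eq matrix_vector_mult_add_rdistrib[abs_def])
  show "norm (r *\<^sub>R a) = \<bar>r\<bar> * norm a"
    using onorm_scaleR[of "(*v) (mat_of a)" r]
    by transfer (simp add: scaleR_matrix_vector_assoc)
  show "norm (a * b) \<le> norm a * norm b"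
    using onorm_compose[of "(*v) (mat_of a)" "(*v) (mat_of b)"]
    by transfer (simp add: o_def matrix_vector_mul_assoc)
  have "(*v) (mat 1 :: real^'a^'a) = (\<lambda>x. x)" by (simp add: fun_eq_iff)
  then show "norm (1 :: 'a sqmat) = 1"
    by (simp add: norm_sqmat.rep_eq one_sqmat.rep_eq onorm_id)
qed (simp_all add: dist_sqmat_def sgn_sqmat_def uniformity_sqmat_def open_sqmat_def)
end

lemma linear_mat_of: "linear mat_of" and linear_sq_of: "linear sq_of"
  by (auto intro!: linearI simp: plus_sqmat.rep_eq scaleR_sqmat.rep_eq
      plus_sqmat.abs_eq scaleR_sqmat.abs_eq)

lemma bounded_linear_mat_of: "bounded_linear (mat_of :: 'n::finite sqmat \<Rightarrow> real^'n^'n)"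
proof -
  have "norm (mat_of a) \<le> norm a * (real CARD('n) * real CARD('n))" for a :: "'n sqmat"
  proof -
    have "norm (mat_of a) \<le> (\<Sum>i\<in>UNIV. \<Sum>j\<in>UNIV. \<bar>mat_of a $ i $ j\<bar>)"
    proof -
      have "norm (mat_of a) \<le> (\<Sum>i\<in>UNIV. norm (mat_of a $ i))"
        unfolding norm_vec_def by (rule L2_set_le_sum) simp
      also have "\<dots> \<le> (\<Sum>i\<in>UNIV. \<Sum>j\<in>UNIV. \<bar>mat_of a $ i $ j\<bar>)"
        by (intro sum_mono norm_le_l1_cart)
      finally show ?thesis .
    qed
    also have "\<dots> \<le> (\<Sum>i\<in>(UNIV :: 'n set). \<Sum>j\<in>(UNIV :: 'n set). norm a)"
      unfolding norm_sqmat.rep_eq by (intro sum_mono matrix_component_le_onorm)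
    finally show ?thesis by (simp add: mult_ac)
  qed
  then show ?thesis
    by (intro bounded_linear_intro) (simp_all add: linear_add linear_scale linear_mat_of)
qed

lemma bounded_linear_sq_of: "bounded_linear (sq_of :: real^'n^'n \<Rightarrow> 'n::finite sqmat)"
  using linear_sq_of by (simp add: linear_conv_bounded_linear)

instance sqmat :: (finite) banach
proof
  fix X :: "nat \<Rightarrow> 'a sqmat"
  assume "Cauchy X"
  then have "Cauchy (\<lambda>n. mat_of (X n))"
    by (rule bounded_linear.Cauchy[OF bounded_linear_mat_of])
  then obtain L where "(\<lambda>n. mat_of (X n)) \<longlonglongrightarrow> L"
    using Cauchy_convergent convergent_def by blast
  then have "(\<lambda>n. sq_of (mat_of (X n))) \<longlonglongrightarrow> sq_of L"
    by (rule bounded_linear.tendsto[OF bounded_linear_sq_of])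
  then show "convergent X"
    by (auto simp: mat_of_inverse convergent_def)
qed

lemma mat_of_power: "mat_of (a ^ k) = matpow (mat_of a) k"
  by (induction k) (simp_all add: matpow_def one_sqmat.rep_eq times_sqmat.rep_eq)

lemma matexp_eq_exp: "matexp A = mat_of (exp (sq_of A))"
proof -
  have "mat_of (exp (sq_of A)) = (\<Sum>k. mat_of (sq_of A ^ k /\<^sub>R fact k))"
    unfolding exp_def by (rule bounded_linear.suminf[OF bounded_linear_mat_of summable_exp_generic])
  also have "\<dots> = matexp A"
    by (simp add: matexp_def scaleR_sqmat.rep_eq mat_of_power sq_of_inverse inverse_eq_divide)
  finally show ?thesis by simp
qed

lemma matexp_0 [simp]: "matexp 0 = mat 1"
  by (simp add: matexp_eq_exp zero_sqmat_def[symmetric] one_sqmat.rep_eq)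

lemma matexp_add:
  assumes "A ** B = B ** A"
  shows "matexp (A + B) = matexp A ** matexp B"
proof -
  have "sq_of A * sq_of B = sq_of B * sq_of A"
    using assms by (simp add: times_sqmat.abs_eq)
  from exp_add_commuting[OF this] show ?thesis
    by (simp add: matexp_eq_exp plus_sqmat.abs_eq flip: times_sqmat.rep_eq)
qed

lemma continuous_on_exp_banach_algebra:
  "continuous_on S (exp :: 'a::{real_normed_algebra_1,banach} \<Rightarrow> 'a)"
proof -
  have cont: "continuous_on (cball 0 r) (exp :: 'a \<Rightarrow> 'a)" for r :: real
  proof (cases "r \<ge> 0")
    case True
    have "uniform_limit (cball 0 r) (\<lambda>n x. \<Sum>k<n. (x::'a) ^ k /\<^sub>R fact k)
            (\<lambda>x. \<Sum>k. x ^ k /\<^sub>R fact k) sequentially"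
    proof (rule Weierstrass_m_test)
      show "summable (\<lambda>k. r ^ k /\<^sub>R fact k)"
        by (rule summable_exp_generic)
    next
      fix k and x :: 'a
      assume "x \<in> cball 0 r"
      then have "norm x ^ k \<le> r ^ k"
        by (intro power_mono) auto
      then have "norm (x ^ k) \<le> r ^ k"
        using norm_power_ineq[of x k] by linarith
      then show "norm (x ^ k /\<^sub>R fact k) \<le> r ^ k /\<^sub>R fact k"
        by (simp add: divide_right_mono field_simps)
    qed
    then show ?thesis
      unfolding exp_def
      by (rule uniform_limit_theorem[rotated]) (auto intro!: always_eventually continuous_intros)
  qed auto
  have "isCont (exp :: 'a \<Rightarrow> 'a) x" for x
  proof -
    have "x \<in> interior (cball 0 (norm x + 1))" by (simp add: interior_cball)
    with cont[of "norm x + 1"] show ?thesis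
      by (metis continuous_on_interior)
  qed
  then show ?thesis
    by (simp add: continuous_at_imp_continuous_on)
qed

lemma continuous_on_matexp [continuous_intros]:
  assumes "continuous_on S f"
  shows "continuous_on S (\<lambda>x. matexp (f x))"
  unfolding matexp_eq_exp
  by (intro bounded_linear.continuous_on[OF bounded_linear_mat_of]
      continuous_on_compose2[OF continuous_on_exp_banach_algebra _ subset_UNIV]
      bounded_linear.continuous_on[OF bounded_linear_sq_of] assms)

lemma exp_commuting:
  fixes a c :: "'a::{real_normed_algebra_1,banach}"
  assumes "a * c = c * a"
  shows "exp a * c = c * exp a"
proof -
  have pw: "a ^ k * c = c * a ^ k" for k
    by (rule power_commuting_commutes[OF assms])
  have "exp a * c = (\<Sum>k. (a ^ k /\<^sub>R fact k) * c)"
    unfolding exp_def by (rule bounded_linear.suminf[OF bounded_linear_mult_left summable_exp_generic])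
  also have "\<dots> = (\<Sum>k. c * (a ^ k /\<^sub>R fact k))"
    by (simp add: pw)
  also have "\<dots> = c * exp a"
    unfolding exp_def by (rule bounded_linear.suminf[OF bounded_linear_mult_right summable_exp_generic, symmetric])
  finally show ?thesis .
qed

lemma matexp_commute:
  assumes "A ** C = C ** A"
  shows "matexp A ** C = C ** matexp A"
proof -
  have "sq_of A * sq_of C = sq_of C * sq_of A"
    using assms by (simp add: times_sqmat.abs_eq)
  then have "mat_of (exp (sq_of A) * sq_of C) = mat_of (sq_of C * exp (sq_of A))"
    by (simp add: exp_commuting)
  then show ?thesis by (simp add: times_sqmat.rep_eq sq_of_inverse matexp_eq_exp)
qed

lemma matexp_has_vector_derivative:
  "((\<lambda>s. matexp (s *\<^sub>R A)) has_vector_derivative A ** matexp (s *\<^sub>R A)) (at s)"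
proof -
  have "((\<lambda>s. mat_of (exp (s *\<^sub>R sq_of A))) has_vector_derivative
          mat_of (sq_of A * exp (s *\<^sub>R sq_of A))) (at s)"
    by (rule bounded_linear.has_vector_derivative[OF bounded_linear_mat_of
          exp_scaleR_has_vector_derivative_left])
  then show ?thesis
    by (simp add: matexp_eq_exp times_sqmat.rep_eq sq_of_inverse scaleR_sqmat.abs_eq)
qed

lemma matexp_minus:
  "matexp A ** matexp (- A) = mat 1" "matexp (- A) ** matexp A = mat 1"
proof -
  have "A ** (- A) = (- A) ** A"
    using matrix_scalar_ac[of A "-1" A] by (simp flip: scalar_matrix_assoc)
  from matexp_add[OF this] matexp_add[OF this[symmetric]]
  show "matexp A ** matexp (- A) = mat 1" "matexp (- A) ** matexp A = mat 1" by simp_all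
qed

section \<open>Logarithms near the identity\<close>

lemma norm_exp_remainder:
  fixes w :: "'a::{real_normed_algebra_1,banach}"
  assumes "norm w \<le> 1"
  shows "norm (exp w - 1 - w) \<le> (norm w)\<^sup>2"
proof -
  have s: "summable (\<lambda>n. inverse (fact (n + 2)) *\<^sub>R (norm w ^ (n + 2)))"
    using summable_exp_generic[of "norm w"] by (subst summable_iff_shift) (simp add: mult.commute)
  have le: "norm (inverse (fact (n + 2)) *\<^sub>R (w ^ (n + 2))) \<le> inverse (fact (n + 2)) *\<^sub>R (norm w ^ (n + 2))" for n
    using norm_power_ineq[of w "n + 2"] by (simp add: mult_left_mono del: power_Suc)
  have "exp w - 1 - w = (\<Sum>n. inverse (fact (n + 2)) *\<^sub>R (w ^ (n + 2)))"
    by (subst exp_first_two_terms) simp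
  then have "norm (exp w - 1 - w) = norm (\<Sum>n. inverse (fact (n + 2)) *\<^sub>R (w ^ (n + 2)))"
    by simp
  also have "\<dots> \<le> (\<Sum>n. inverse (fact (n + 2)) *\<^sub>R (norm w ^ (n + 2)))"
    by (rule norm_suminf_le[OF le s])
  also have "\<dots> = exp (norm w) - 1 - norm w"
    by (subst exp_first_two_terms) simp
  also have "\<dots> \<le> (norm w)\<^sup>2"
    using exp_bound[of "norm w"] assms by simp
  finally show ?thesis .
qed

lemma norm_exp_minus_one:
  fixes w :: "'a::{real_normed_algebra_1,banach}"
  assumes "norm w \<le> 1"
  shows "norm (exp w - 1) \<le> 2 * norm w"
proof -
  have "norm (exp w - 1) \<le> norm (exp w - 1 - w) + norm w"
    using norm_triangle_ineq[of "exp w - 1 - w" w] by simp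
  also have "\<dots> \<le> (norm w)\<^sup>2 + norm w"
    using norm_exp_remainder[OF assms] by simp
  also have "(norm w)\<^sup>2 \<le> norm w"
    using assms by (simp add: power2_eq_square mult_left_le)
  finally show ?thesis by simp
qed

text \<open>
  Near \<open>1\<close> the exponential is onto, and the logarithm can be taken in any commutative subalgebra that
  is a commutant. Commutativity is what gives
  \<open>exp x - exp y = exp y * (exp (x - y) - 1)\<close>, from which the contraction estimate follows.
\<close>

lemma exp_log_exists:
  fixes z :: "'a::{real_normed_algebra_1,banach}" and C :: "'a set"
  defines "S \<equiv> {a. \<forall>c\<in>C. a * c = c * a}"
  assumes "S \<subseteq> C" and z: "z \<in> S" "norm z \<le> 1/16"
  shows "\<exists>x\<in>S. norm x \<le> 1/8 \<and> exp x = 1 + z"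
proof -
  have comm: "a * b = b * a" if "a \<in> S" "b \<in> S" for a b
    using that assms by (auto simp: S_def)
  have exp_S: "exp a \<in> S" if "a \<in> S" for a
    using that exp_commuting by (auto simp: S_def)
  have diff_S: "a - b \<in> S" and add_S: "a + b \<in> S" if "a \<in> S" "b \<in> S" for a b
    using that by (auto simp: S_def algebra_simps)
  have one_S: "1 \<in> S" by (simp add: S_def)
  have "S = (\<Inter>c\<in>C. {a. a * c = c * a})" by (auto simp: S_def)
  then have closed_S: "closed S"
    by (auto intro!: closed_INT closed_Collect_eq continuous_intros)
  \<comment> \<open>A fixed point of \<open>f\<close> is a logarithm of \<open>1 + z\<close>.\<close>
  define f where "f x = z + 1 + x - exp x" for x :: 'a
  define D where "D = S \<inter> cball 0 (1/8)"
  have "\<exists>!x\<in>D. f x = x"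
  proof (rule Banach_fix)
    show "complete D"
      unfolding D_def complete_eq_closed using closed_S by blast
    have "0 \<in> D" by (simp add: D_def S_def)
    then show "D \<noteq> {}" by blast
    show "(0::real) \<le> 3/4" "(3/4::real) < 1" by auto
    show "f ` D \<subseteq> D"
    proof
      fix y assume "y \<in> f ` D"
      then obtain x where x: "x \<in> S" "norm x \<le> 1/8" and y: "y = f x" by (auto simp: D_def)
      have "y = z - (exp x - 1 - x)" by (simp add: y f_def)
      then have "norm y \<le> norm z + norm (exp x - 1 - x)"
        using norm_triangle_ineq4 by metis
      also have "norm (exp x - 1 - x) \<le> (norm x)\<^sup>2"
        by (rule norm_exp_remainder) (use x in simp)
      also have "\<dots> \<le> (1/8)\<^sup>2" by (rule power_mono) (use x in auto)
      finally have "norm y \<le> 1/8" using z by (simp add: power2_eq_square)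
      moreover have "y \<in> S"
        unfolding y f_def by (intro diff_S add_S exp_S one_S x z)
      ultimately show "y \<in> D" by (simp add: D_def)
    qed
    fix x y assume "x \<in> D" "y \<in> D"
    then have x: "x \<in> S" "norm x \<le> 1/8" and y: "y \<in> S" "norm y \<le> 1/8" by (auto simp: D_def)
    define w where "w = x - y"
    have w: "norm w \<le> 1/4" using norm_triangle_ineq4[of x y] x y by (simp add: w_def)
    have "exp x = exp y * exp w"
      using exp_add_commuting[of y w] comm[OF y(1) diff_S[OF x(1) y(1)]] by (simp add: w_def)
    then have "f x - f y = - ((exp y - 1) * (exp w - 1) + (exp w - 1 - w))"
      by (simp add: f_def w_def algebra_simps)
    then have "norm (f x - f y) \<le> norm ((exp y - 1) * (exp w - 1)) + norm (exp w - 1 - w)"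
      using norm_triangle_ineq norm_minus_cancel by metis
    also have "norm ((exp y - 1) * (exp w - 1)) \<le> norm (exp y - 1) * norm (exp w - 1)"
      by (rule norm_mult_ineq)
    also have "\<dots> \<le> (2 * norm y) * (2 * norm w)"
      by (intro mult_mono norm_exp_minus_one) (use y w in auto)
    also have "\<dots> \<le> (1/4) * (2 * norm w)"
      by (rule mult_right_mono) (use y in auto)
    also have "norm (exp w - 1 - w) \<le> (norm w)\<^sup>2"
      by (rule norm_exp_remainder) (use w in simp)
    also have "(norm w)\<^sup>2 \<le> (1/4) * norm w"
      unfolding power2_eq_square by (rule mult_right_mono) (use w in auto)
    finally show "dist (f x) (f y) \<le> 3/4 * dist x y"
      by (simp add: dist_norm w_def)
  qed
  then obtain x where "x \<in> D" "f x = x" by blast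
  then show ?thesis
    by (intro bexI[of _ x]) (auto simp: D_def f_def algebra_simps)
qed

text \<open>
  The commutant of a set of matrices. It is commutative as soon as it is contained in the set itself,
  which is the case for the bicommutant of a commuting family.
\<close>

definition centralizer :: "(real^'n^'n) set \<Rightarrow> (real^'n^'n) set" where
  "centralizer C = {A. \<forall>c\<in>C. A ** c = c ** A}"

lemma matexp_log_exists:
  fixes C :: "(real^'n^'n) set"
  assumes "centralizer C \<subseteq> C"
  obtains \<delta> r where "\<delta> > 0"
    "\<And>E. E \<in> centralizer C \<Longrightarrow> norm (E - mat 1) < \<delta> \<Longrightarrow>
       \<exists>X \<in> centralizer C. norm X \<le> r \<and> matexp X = E"
proof -
  obtain K where K: "K > 0" "\<And>A :: real^'n^'n. norm (sq_of A) \<le> norm A * K"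
    using bounded_linear.pos_bounded[OF bounded_linear_sq_of] by blast
  obtain L where L: "L > 0" "\<And>a :: 'n sqmat. norm (mat_of a) \<le> norm a * L"
    using bounded_linear.pos_bounded[OF bounded_linear_mat_of] by blast
  define C' where "C' = sq_of ` C"
  have in_cen: "sq_of A \<in> {a. \<forall>c\<in>C'. a * c = c * a} \<longleftrightarrow> A \<in> centralizer C" for A
    by (simp add: C'_def centralizer_def times_sqmat.abs_eq sq_of_inject)
  have sub: "{a. \<forall>c\<in>C'. a * c = c * a} \<subseteq> C'"
  proof
    fix a assume a: "a \<in> {a. \<forall>c\<in>C'. a * c = c * a}"
    then have "sq_of (mat_of a) \<in> {a. \<forall>c\<in>C'. a * c = c * a}" by (simp add: mat_of_inverse)
    then have "mat_of a \<in> C" using assms unfolding in_cen by blast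
    then show "a \<in> C'" unfolding C'_def by (metis image_eqI mat_of_inverse)
  qed
  show ?thesis
  proof (rule that[of "1 / (16 * K)" "1/8 * L"])
    show "1 / (16 * K) > 0" using K by simp
    fix E assume E: "E \<in> centralizer C" "norm (E - mat 1) < 1 / (16 * K)"
    have "mat 1 \<in> centralizer C" by (simp add: centralizer_def)
    then have "E - mat 1 \<in> centralizer C"
      using E by (simp add: centralizer_def vec_eq_iff matrix_matrix_mult_def
          left_diff_distrib right_diff_distrib sum_subtractf)
    then have "sq_of (E - mat 1) \<in> {a. \<forall>c\<in>C'. a * c = c * a}" by (simp only: in_cen)
    moreover have "norm (sq_of (E - mat 1)) \<le> 1/16"
      using K(2)[of "E - mat 1"] E(2) K(1) by (simp add: field_simps)
    ultimately obtain x where x: "x \<in> {a. \<forall>c\<in>C'. a * c = c * a}" "norm x \<le> 1/8"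
        "exp x = 1 + sq_of (E - mat 1)"
      using exp_log_exists[OF sub] by blast
    have "mat_of x \<in> centralizer C" using x(1) in_cen[of "mat_of x"] by (simp add: mat_of_inverse)
    moreover have "norm (mat_of x) \<le> 1/8 * L"
      using L(2)[of x] mult_right_mono[OF x(2), of L] L(1) by linarith
    moreover have "matexp (mat_of x) = E"
      by (simp add: matexp_eq_exp mat_of_inverse x(3) plus_sqmat.rep_eq one_sqmat.rep_eq sq_of_inverse)
    ultimately show "\<exists>X \<in> centralizer C. norm X \<le> 1/8 * L \<and> matexp X = E" by blast
  qed
qed

section \<open>Bounded one-parameter groups\<close>

lemma bounded_bilinear_matrix_mult:
  "bounded_bilinear ((**) :: real^'m^'n \<Rightarrow> real^'k^'m \<Rightarrow> real^'k^'n)"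
  unfolding bilinear_conv_bounded_bilinear[symmetric] bilinear_def
  by (auto intro!: linearI simp: vec_eq_iff matrix_matrix_mult_def sum.distrib
      distrib_left distrib_right sum_distrib_left mult_ac)

lemma bounded_bilinear_matrix_vector_mult:
  "bounded_bilinear ((*v) :: real^'m^'n \<Rightarrow> real^'m \<Rightarrow> real^'n)"
  unfolding bilinear_conv_bounded_bilinear[symmetric] bilinear_def
  by (auto intro!: linearI simp: vec_eq_iff matrix_vector_mult_def sum.distrib
      distrib_left distrib_right sum_distrib_left mult_ac)

lemma bounded_linear_transpose:
  "bounded_linear (transpose :: real^'m^'n \<Rightarrow> real^'n^'m)"
  unfolding linear_conv_bounded_linear[symmetric]
  by (auto intro!: linearI simp: vec_eq_iff transpose_def)

lemmas matrix_add_rdistrib = bounded_bilinear.add_left[OF bounded_bilinear_matrix_mult]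
lemmas matrix_minus_left = bounded_bilinear.minus_left[OF bounded_bilinear_matrix_mult]
lemmas matrix_minus_right = bounded_bilinear.minus_right[OF bounded_bilinear_matrix_mult]
lemmas matrix_scaleR_left = bounded_bilinear.scaleR_left[OF bounded_bilinear_matrix_mult]
lemmas matrix_scaleR_right = bounded_bilinear.scaleR_right[OF bounded_bilinear_matrix_mult]
lemmas matrix_diff_left = bounded_bilinear.diff_left[OF bounded_bilinear_matrix_mult]
lemmas transpose_scaleR = linear_scale[OF bounded_linear.linear[OF bounded_linear_transpose]]

text \<open>
  The columns of \<open>P\<close> form an orthonormal basis for the inner product given by \<open>Q\<close>; they are built by
  Gram-Schmidt, one index at a time.
\<close>

lemma positive_definite_orthonormal_basis:
  fixes Q :: "real^'n^'n"
  assumes sym: "transpose Q = Q" and pos: "\<And>x. x \<noteq> 0 \<Longrightarrow> 0 < x \<bullet> (Q *v x)"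
  obtains P :: "real^'n^'n" where "transpose P ** Q ** P = mat 1"
proof -
  have swap: "x \<bullet> (Q *v y) = (Q *v x) \<bullet> y" for x y
    by (metis dot_lmul_matrix sym transpose_matrix_vector)
  have "\<exists>v :: 'n \<Rightarrow> real^'n. \<forall>i\<in>F. \<forall>j\<in>F. v i \<bullet> (Q *v v j) = (if i = j then 1 else 0)"
    if "finite F" for F :: "'n set"
    using that
  proof (induction F rule: finite_induct)
    case (insert a F)
    then obtain v :: "'n \<Rightarrow> real^'n"
      where v: "\<And>i j. i \<in> F \<Longrightarrow> j \<in> F \<Longrightarrow> v i \<bullet> (Q *v v j) = (if i = j then 1 else 0)"
      by blast
    have "dim ((\<lambda>i. Q *v v i) ` F) \<le> card ((\<lambda>i. Q *v v i) ` F)"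
      by (rule dim_le_card') (simp add: insert)
    also have "\<dots> \<le> card F" by (rule card_image_le) (simp add: insert)
    also have "\<dots> < card (insert a F)" using insert by simp
    also have "\<dots> \<le> CARD('n)" by (rule card_mono) auto
    finally have "dim ((\<lambda>i. Q *v v i) ` F) < DIM(real^'n)" by simp
    then obtain x where x: "x \<noteq> 0" "\<And>y. y \<in> span ((\<lambda>i. Q *v v i) ` F) \<Longrightarrow> orthogonal x y"
      using orthogonal_to_subspace_exists by blast
    have x0: "x \<bullet> (Q *v v i) = 0" if "i \<in> F" for i
      using x(2)[OF span_base] that by (auto simp: orthogonal_def)
    have q: "0 < x \<bullet> (Q *v x)" using pos x(1) by blast
    define w where "w = (1 / sqrt (x \<bullet> (Q *v x))) *\<^sub>R x"
    have "w \<bullet> (Q *v w) = 1"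
      using q by (simp add: w_def matrix_vector_mult_scaleR field_simps)
    moreover have "w \<bullet> (Q *v v i) = 0" "v i \<bullet> (Q *v w) = 0" if "i \<in> F" for i
      using x0[OF that] swap[of "v i" w] by (simp_all add: w_def inner_commute)
    ultimately have "\<forall>i\<in>insert a F. \<forall>j\<in>insert a F.
        (v(a := w)) i \<bullet> (Q *v (v(a := w)) j) = (if i = j then 1 else 0)"
      using v insert(2) by (auto simp: fun_upd_def)
    then show ?case by blast
  qed simp
  from this[of UNIV] obtain v :: "'n \<Rightarrow> real^'n"
    where v: "\<And>i j. v i \<bullet> (Q *v v j) = (if i = j then 1 else 0)" by auto
  define P :: "real^'n^'n" where "P = (\<chi> i j. v j $ i)"
  have "(transpose P ** (Q ** P)) $ i $ j = v i \<bullet> (Q *v v j)" for i j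
    by (simp add: P_def matrix_matrix_mult_def transpose_def inner_vec_def matrix_vector_mult_def)
  then have "transpose P ** Q ** P = mat 1"
    by (simp add: vec_eq_iff mat_def v flip: matrix_mul_assoc)
  then show ?thesis by (rule that)
qed

lemma matrix_inv_eqI:
  fixes A A' :: "real^'n^'n"
  assumes "A' ** A = mat 1"
  shows "matrix_inv A = A'"
proof -
  have "A ** A' = mat 1" using assms by (simp add: matrix_left_right_inverse)
  then have "A ** matrix_inv A = mat 1"
    unfolding matrix_inv_def using assms by (metis (mono_tags, lifting) someI)
  then have "A' ** (A ** matrix_inv A) = A'" by simp
  then show ?thesis by (simp add: matrix_mul_assoc assms)
qed

text \<open>
  A bounded one-parameter group leaves an inner product invariant: a limit, as \<open>T\<close> tends to infinity,
  of the averages over \<open>[0, T]\<close> of the standard inner product moved by \<open>matexp (s *\<^sub>R A)\<close>. The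
  infinitesimal action of \<open>A\<close> on the average telescopes to \<open>(X T - X 0) / T\<close>.
\<close>

lemma bounded_matexp_imp_invariant_form:
  fixes A :: "real^'n^'n"
  assumes "bounded (range (\<lambda>s. matexp (s *\<^sub>R A)))"
  obtains Q where "transpose Q = Q" "\<And>x. x \<noteq> 0 \<Longrightarrow> 0 < x \<bullet> (Q *v x)"
    "transpose A ** Q + Q ** A = 0"
proof -
  define E where "E s = matexp (s *\<^sub>R A)" for s
  define X where "X s = transpose (E s) ** E s" for s
  define \<Lambda> where "\<Lambda> Y = transpose A ** Y + Y ** A" for Y
  have bl_\<Lambda>: "bounded_linear \<Lambda>"
    unfolding \<Lambda>_def
    by (intro bounded_linear_add bounded_bilinear.bounded_linear_right[OF bounded_bilinear_matrix_mult]
        bounded_bilinear.bounded_linear_left[OF bounded_bilinear_matrix_mult])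
  have bl_form: "bounded_linear (\<lambda>Y :: real^'n^'n. x \<bullet> (Y *v x))" for x
    by (intro bounded_linear_compose[OF bounded_linear_inner_right]
        bounded_bilinear.bounded_linear_left[OF bounded_bilinear_matrix_vector_mult])
  obtain C where C: "C > 0" "\<And>s. norm (E s) \<le> C"
    using assms unfolding bounded_pos E_def by auto
  obtain K where K: "K > 0" "\<And>(Y :: real^'n^'n) x. norm (Y *v x) \<le> norm Y * norm x * K"
    using bounded_bilinear.pos_bounded[OF bounded_bilinear_matrix_vector_mult] by blast
  obtain K2 where K2: "K2 > 0" "\<And>(Y :: real^'n^'n) (Z :: real^'n^'n). norm (Y ** Z) \<le> norm Y * norm Z * K2"
    using bounded_bilinear.pos_bounded[OF bounded_bilinear_matrix_mult] by blast
  obtain K3 where K3: "K3 > 0" "\<And>Y :: real^'n^'n. norm (transpose Y) \<le> norm Y * K3"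
    using bounded_linear.pos_bounded[OF bounded_linear_transpose] by blast
  define D where "D = (C * K3) * C * K2"
  have X_le: "norm (X s) \<le> D" for s
  proof -
    have "norm (transpose (E s)) \<le> C * K3"
      using K3(2)[of "E s"] mult_right_mono[OF C(2)[of s], of K3] K3(1) by linarith
    then have "norm (transpose (E s)) * norm (E s) * K2 \<le> D"
      unfolding D_def by (intro mult_right_mono mult_mono C(2)) (use C K2 K3 in auto)
    then show ?thesis using K2(2) unfolding X_def by (meson order_trans)
  qed
  have form: "x \<bullet> (X s *v x) = (norm (E s *v x))\<^sup>2" for s x
    unfolding X_def power2_norm_eq_inner
    by (metis dot_lmul_matrix inner_commute matrix_vector_mul_assoc transpose_matrix_vector transpose_transpose)
  define c where "c = 1 / (C * K)\<^sup>2"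
  have c: "c > 0" using C K by (simp add: c_def)
  \<comment> \<open>The inverse \<open>E (- s)\<close> is bounded as well, so the forms \<open>X s\<close> are uniformly positive.\<close>
  have form_ge: "c * (norm x)\<^sup>2 \<le> x \<bullet> (X s *v x)" for s x
  proof -
    have "x = E (- s) *v (E s *v x)"
      by (simp add: E_def matrix_vector_mul_assoc matexp_minus)
    then have "norm x \<le> norm (E (- s)) * norm (E s *v x) * K"
      using K(2) by metis
    also have "\<dots> \<le> C * norm (E s *v x) * K"
      using C K by (intro mult_right_mono) auto
    finally have "norm x \<le> (C * K) * norm (E s *v x)" by (simp add: mult_ac)
    then have "(norm x)\<^sup>2 \<le> (C * K)\<^sup>2 * (norm (E s *v x))\<^sup>2"
      by (metis norm_ge_zero power_mono power_mult_distrib)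
    then show ?thesis
      using C K by (simp add: form c_def field_simps)
  qed
  have cont_X: "continuous_on S X" for S
    unfolding X_def E_def
    by (intro bounded_bilinear.continuous_on[OF bounded_bilinear_matrix_mult]
        bounded_linear.continuous_on[OF bounded_linear_transpose] continuous_intros)
  have deriv: "(X has_vector_derivative \<Lambda> (X s)) (at s within S)" for s S
  proof -
    have dE: "(E has_vector_derivative A ** E s) (at s within S)"
      unfolding E_def[abs_def] by (rule has_vector_derivative_at_within[OF matexp_has_vector_derivative])
    have "A ** E s = E s ** A"
      unfolding E_def by (rule matexp_commute[symmetric]) (simp add: matrix_scaleR_left matrix_scaleR_right)
    then have "transpose (E s) ** (A ** E s) + transpose (A ** E s) ** E s = \<Lambda> (X s)"
      by (simp add: \<Lambda>_def X_def matrix_transpose_mul matrix_mul_assoc)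
    then show ?thesis
      using bounded_bilinear.has_vector_derivative[OF bounded_bilinear_matrix_mult
          bounded_linear.has_vector_derivative[OF bounded_linear_transpose dE] dE]
      by (simp add: X_def[abs_def])
  qed
  have int_X: "X integrable_on {0..T}" for T
    by (intro integrable_continuous_real cont_X)
  define Q where "Q n = (1 / real (Suc n)) *\<^sub>R integral {0..real (Suc n)} X" for n
  have Q_le: "norm (Q n) \<le> D" for n
  proof -
    have "norm (integral {0..real (Suc n)} X) \<le> D * (real (Suc n) - 0)"
      by (rule integral_bound) (use cont_X X_le in auto)
    then show ?thesis by (simp add: Q_def field_simps)
  qed
  then obtain Q0 f where f: "strict_mono f" and lim: "(\<lambda>n. Q (f n)) \<longlonglongrightarrow> Q0"
    using bounded_imp_convergent_subsequence[of Q] boundedI[of "range Q" D]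
    by (auto simp: o_def)
  have sym: "transpose (Q n) = Q n" for n
  proof -
    have "transpose (integral {0..real (Suc n)} X) = integral {0..real (Suc n)} (transpose \<circ> X)"
      by (rule integral_linear[symmetric, OF int_X bounded_linear_transpose])
    also have "transpose \<circ> X = X"
      by (auto simp: X_def matrix_transpose_mul)
    finally show ?thesis by (simp add: Q_def transpose_scaleR)
  qed
  have "transpose Q0 = Q0"
    using bounded_linear.tendsto[OF bounded_linear_transpose lim] lim
    unfolding sym by (rule LIMSEQ_unique)
  moreover have "0 < x \<bullet> (Q0 *v x)" if "x \<noteq> 0" for x
  proof -
    have "c * (norm x)\<^sup>2 \<le> x \<bullet> (Q n *v x)" for n
    proof -
      have "integral {0..real (Suc n)} (\<lambda>_. c * (norm x)\<^sup>2)
            \<le> integral {0..real (Suc n)} ((\<lambda>Y. x \<bullet> (Y *v x)) \<circ> X)"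
        by (intro integral_le integrable_linear[OF int_X bl_form] integrable_const_ivl)
          (simp add: form_ge)
      also have "\<dots> = x \<bullet> (integral {0..real (Suc n)} X *v x)"
        by (rule integral_linear[OF int_X bl_form])
      finally have "real (Suc n) * (c * (norm x)\<^sup>2) \<le> x \<bullet> (integral {0..real (Suc n)} X *v x)"
        by (simp add: mult_ac del: of_nat_Suc)
      then show ?thesis
        unfolding Q_def using linear_scale[OF bounded_linear.linear[OF bl_form[of x]]]
        by (simp add: field_simps)
    qed
    then have "c * (norm x)\<^sup>2 \<le> x \<bullet> (Q0 *v x)"
      by (intro LIMSEQ_le_const[OF bounded_linear.tendsto[OF bl_form lim]]) auto
    moreover have "c * (norm x)\<^sup>2 > 0" using c that by simp
    ultimately show ?thesis by linarith
  qed
  moreover have "\<Lambda> Q0 = 0"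
  proof -
    have "\<Lambda> (Q n) = (1 / real (Suc n)) *\<^sub>R (X (real (Suc n)) - X 0)" for n
    proof -
      have "\<Lambda> (integral {0..real (Suc n)} X) = integral {0..real (Suc n)} (\<Lambda> \<circ> X)"
        by (rule integral_linear[symmetric, OF int_X bl_\<Lambda>])
      also have "\<dots> = X (real (Suc n)) - X 0"
        by (rule integral_unique, rule fundamental_theorem_of_calculus) (auto intro: deriv)
      finally show ?thesis
        by (simp add: Q_def linear_scale[OF bounded_linear.linear[OF bl_\<Lambda>]])
    qed
    then have le: "norm (\<Lambda> (Q n)) \<le> (2 * D) * (1 / real (Suc n))" for n
      using norm_triangle_ineq4[of "X (real (Suc n))" "X 0"] X_le[of "real (Suc n)"] X_le[of 0]
      by (simp add: divide_right_mono)
    have lim0: "(\<lambda>n. (2 * D) * (1 / real (Suc n))) \<longlonglongrightarrow> (2 * D) * 0"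
      by (intro tendsto_mult tendsto_const) (use LIMSEQ_inverse_real_of_nat in \<open>simp add: inverse_eq_divide\<close>)
    have "(\<lambda>n. \<Lambda> (Q n)) \<longlonglongrightarrow> 0"
      by (rule Lim_null_comparison[OF always_eventually[OF allI[OF le]] lim0[unfolded mult_zero_right]])
    from LIMSEQ_subseq_LIMSEQ[OF this f] have "(\<lambda>n. \<Lambda> (Q (f n))) \<longlonglongrightarrow> 0"
      by (simp only: o_def)
    with bounded_linear.tendsto[OF bl_\<Lambda> lim] show ?thesis
      by (rule LIMSEQ_unique)
  qed
  ultimately show ?thesis using that unfolding \<Lambda>_def by blast
qed

lemma bounded_matexp_imp_similar_skew:
  fixes A :: "real^'n^'n"
  assumes "bounded (range (\<lambda>s. matexp (s *\<^sub>R A)))"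
  shows "\<exists>S. skew_symmetric S \<and> similar_matrix A S"
proof -
  obtain Q where Q: "transpose Q = Q" "\<And>x. x \<noteq> 0 \<Longrightarrow> 0 < x \<bullet> (Q *v x)"
    and inv: "transpose A ** Q + Q ** A = 0"
    using bounded_matexp_imp_invariant_form[OF assms] by blast
  obtain P :: "real^'n^'n" where P: "transpose P ** Q ** P = mat 1"
    using positive_definite_orthonormal_basis[OF Q] by blast
  define P' where "P' = transpose P ** Q"
  have P'P: "P' ** P = mat 1" using P by (simp add: P'_def)
  then have PP': "P ** P' = mat 1" by (simp add: matrix_left_right_inverse)
  define S where "S = P' ** A ** P"
  have "transpose A ** Q = - (Q ** A)" using inv by (simp add: eq_neg_iff_add_eq_0)
  then have "transpose P ** (transpose A ** Q) ** P = - S"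
    by (simp add: S_def P'_def matrix_minus_left matrix_minus_right matrix_mul_assoc)
  then have "transpose S = - S"
    by (simp add: S_def P'_def matrix_transpose_mul Q(1) matrix_mul_assoc)
  moreover have "A = P ** S ** matrix_inv P"
    unfolding S_def matrix_inv_eqI[OF P'P]
    by (metis PP' matrix_mul_assoc matrix_mul_lid matrix_mul_rid)
  moreover have "invertible P" using P'P PP' by (auto simp: invertible_def)
  ultimately show ?thesis
    unfolding skew_symmetric_def similar_matrix_def by blast
qed

section \<open>Properness of the two-parameter exponential\<close>

lemma linear_pt: "linear (pt p)"
  by (rule linearI) (simp_all add: pt_def algebra_simps)

lemma linear_Bt: "linear (Bt B)"
  by (rule linearI) (simp_all add: Bt_def algebra_simps)

lemmas bounded_linear_pt = linear_pt[unfolded linear_conv_bounded_linear]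
lemmas bounded_linear_Bt = linear_Bt[unfolded linear_conv_bounded_linear]

lemma pt_simps [simp]: "pt p 0 = 0" "pt p (s + t) = pt p s + pt p t" "pt p (- t) = - pt p t"
  "pt p (s - t) = pt p s - pt p t" "pt p (c *\<^sub>R t) = c * pt p t"
  using linear_0[OF linear_pt] linear_add[OF linear_pt] linear_neg[OF linear_pt]
    linear_diff[OF linear_pt] linear_scale[OF linear_pt] by auto

lemma Bt_simps [simp]: "Bt B 0 = 0" "Bt B (s + t) = Bt B s + Bt B t" "Bt B (- t) = - Bt B t"
  "Bt B (s - t) = Bt B s - Bt B t" "Bt B (c *\<^sub>R t) = c *\<^sub>R Bt B t"
  by (simp_all add: linear_0[OF linear_Bt] linear_add[OF linear_Bt] linear_neg[OF linear_Bt]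
    linear_diff[OF linear_Bt] linear_scale[OF linear_Bt])

lemma Bt_commute:
  assumes "B $ 1 ** B $ 2 = B $ 2 ** B $ 1"
  shows "Bt B s ** Bt B t = Bt B t ** Bt B s"
  by (simp add: Bt_def matrix_add_rdistrib matrix_add_ldistrib matrix_scaleR_left
      matrix_scaleR_right assms algebra_simps)

lemma subspace_centralizer: "subspace (centralizer C)"
  by (auto simp: subspace_def centralizer_def matrix_add_rdistrib matrix_add_ldistrib
      matrix_scaleR_left matrix_scaleR_right)

lemma matexp_in_centralizer: "A \<in> centralizer C \<Longrightarrow> matexp A \<in> centralizer C"
  by (simp add: centralizer_def matexp_commute)

text \<open>The one-parameter group through a point with exponential \<open>1\<close> is periodic.\<close>

lemma matexp_eq_one_imp_bounded:
  fixes Y :: "real^'n^'n"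
  assumes "matexp Y = mat 1"
  shows "bounded (range (\<lambda>s. matexp (s *\<^sub>R Y)))"
proof -
  define g where "g s = matexp (s *\<^sub>R Y)" for s
  have step: "g (s + 1) = g s" for s
    using matexp_add[of "s *\<^sub>R Y" Y] assms
    by (simp add: g_def scaleR_add_left matrix_scaleR_left matrix_scaleR_right)
  have shift: "g (s + real n) = g s" for s n
  proof (induction n)
    case (Suc n)
    then show ?case using step[of "s + real n"] by (simp add: add_ac)
  qed simp
  have "g s = g (frac s)" for s
  proof (cases "\<lfloor>s\<rfloor> \<ge> 0")
    case True
    then have "s = frac s + real (nat \<lfloor>s\<rfloor>)" by (simp add: frac_def)
    then show ?thesis using shift by metis
  next
    case False
    then have "frac s = s + real (nat (- \<lfloor>s\<rfloor>))" by (simp add: frac_def)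
    then show ?thesis using shift by metis
  qed
  then have "range g \<subseteq> g ` {0..1}"
    by (metis atLeastAtMost_iff frac_ge_0 frac_lt_1 image_eqI image_subsetI less_imp_le)
  moreover have "compact (g ` {0..1})"
    unfolding g_def by (intro compact_continuous_image continuous_intros) auto
  ultimately show ?thesis
    unfolding g_def using bounded_subset compact_imp_bounded by blast
qed

text \<open>
  In a commutative algebra the generators of bounded one-parameter groups form a linear subspace, which
  is closed because the dimension is finite.
\<close>

lemma subspace_bounded_matexp:
  fixes C :: "(real^'n^'n) set"
  assumes "centralizer C \<subseteq> C"
  shows "subspace {Y \<in> centralizer C. bounded (range (\<lambda>s. matexp (s *\<^sub>R Y)))}"
proof -
  have "bounded (range (\<lambda>s. matexp (s *\<^sub>R (Y + Z))))"
    if Y: "Y \<in> centralizer C" "bounded (range (\<lambda>s. matexp (s *\<^sub>R Y)))"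
      and Z: "Z \<in> centralizer C" "bounded (range (\<lambda>s. matexp (s *\<^sub>R Z)))" for Y Z
  proof -
    have "Y ** Z = Z ** Y" using Y(1) Z(1) assms by (auto simp: centralizer_def)
    then have split: "matexp (s *\<^sub>R (Y + Z)) = matexp (s *\<^sub>R Y) ** matexp (s *\<^sub>R Z)" for s
      unfolding scaleR_add_right
      by (intro matexp_add) (simp add: matrix_scaleR_left matrix_scaleR_right)
    obtain a where a: "\<And>s. norm (matexp (s *\<^sub>R Y)) \<le> a" using Y(2) unfolding bounded_iff by auto
    obtain b where b: "\<And>s. norm (matexp (s *\<^sub>R Z)) \<le> b" using Z(2) unfolding bounded_iff by auto
    obtain K where K: "K > 0" "\<And>(Y :: real^'n^'n) (Z :: real^'n^'n). norm (Y ** Z) \<le> norm Y * norm Z * K"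
      using bounded_bilinear.pos_bounded[OF bounded_bilinear_matrix_mult] by blast
    have "norm (matexp (s *\<^sub>R (Y + Z))) \<le> a * b * K" for s
    proof -
      have "0 \<le> a" using a order_trans norm_ge_zero by blast
      have "norm (matexp (s *\<^sub>R (Y + Z))) \<le> norm (matexp (s *\<^sub>R Y)) * norm (matexp (s *\<^sub>R Z)) * K"
        unfolding split by (rule K)
      also have "\<dots> \<le> a * b * K"
        using K(1) \<open>0 \<le> a\<close> by (intro mult_right_mono mult_mono a b) auto
      finally show ?thesis .
    qed
    then show ?thesis unfolding bounded_iff by auto
  qed
  moreover have "bounded (range (\<lambda>s. matexp (s *\<^sub>R (c *\<^sub>R Y))))"
    if "bounded (range (\<lambda>s. matexp (s *\<^sub>R Y)))" for c and Y :: "real^'n^'n"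
    by (rule bounded_subset[OF that]) auto
  ultimately show ?thesis
    using subspace_centralizer[of C] by (auto simp: subspace_def)
qed

text \<open>
  The central step. If \<open>t k\<close> escapes to infinity while \<open>matexp (Bt B (t k))\<close> converges, then the
  exponential of \<open>Bt B (t k - t N)\<close> is eventually close to \<open>1\<close>, hence has a logarithm \<open>X k\<close> in the
  bicommutant that stays bounded. The element \<open>Bt B (t k - t N) - X k\<close> has exponential \<open>1\<close> and so
  generates a bounded group; divided by \<open>norm (t k)\<close> these elements tend to \<open>Bt B u\<close>, which therefore
  also generates a bounded group.
\<close>

lemma bounded_matexp_limit_direction:
  fixes B :: "(real^'n^'n)^2" and t :: "nat \<Rightarrow> real^2"
  assumes comm: "B $ 1 ** B $ 2 = B $ 2 ** B $ 1"
    and inf: "filterlim (\<lambda>k. norm (t k)) at_top sequentially"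
    and conv: "convergent (\<lambda>k. matexp (Bt B (t k)))"
    and bdd: "bounded (range (\<lambda>k. matexp (- Bt B (t k))))"
    and dir: "(\<lambda>k. (1 / norm (t k)) *\<^sub>R t k) \<longlonglongrightarrow> u"
  shows "bounded (range (\<lambda>s. matexp (s *\<^sub>R Bt B u)))"
proof -
  \<comment> \<open>\<open>S\<close> is the bicommutant of \<open>B $ 1\<close> and \<open>B $ 2\<close>, a commutative algebra containing all \<open>Bt B s\<close>.\<close>
  define C where "C = centralizer {B $ 1, B $ 2}"
  define S where "S = centralizer C"
  have Bt_C: "Bt B s \<in> C" for s
    by (simp add: C_def Bt_def centralizer_def comm matrix_add_rdistrib matrix_add_ldistrib
      matrix_scaleR_left matrix_scaleR_right)
  have Bt_S: "Bt B s \<in> S" for s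
    by (auto simp: S_def C_def Bt_def centralizer_def matrix_add_rdistrib matrix_add_ldistrib
      matrix_scaleR_left matrix_scaleR_right)
  have S_C: "S \<subseteq> C"
    using Bt_C[of "axis 1 1"] Bt_C[of "axis 2 1"]
    unfolding S_def C_def by (auto simp: Bt_def centralizer_def axis_def)
  obtain \<delta> r where \<delta>: "\<delta> > 0"
    and log: "\<And>E. E \<in> S \<Longrightarrow> norm (E - mat 1) < \<delta> \<Longrightarrow> \<exists>X\<in>S. norm X \<le> r \<and> matexp X = E"
    using matexp_log_exists[of C] S_C unfolding S_def by metis
  obtain b where b: "b > 0" "\<And>k. norm (matexp (- Bt B (t k))) \<le> b"
    using bdd unfolding bounded_pos by auto
  obtain K where K: "K > 0" "\<And>(Y :: real^'n^'n) (Z :: real^'n^'n). norm (Y ** Z) \<le> norm Y * norm Z * K"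
    using bounded_bilinear.pos_bounded[OF bounded_bilinear_matrix_mult] by blast
  have "\<delta> / (b * K) > 0" using \<delta> b K by simp
  then obtain N where N: "\<And>k. k \<ge> N \<Longrightarrow>
      norm (matexp (Bt B (t k)) - matexp (Bt B (t N))) < \<delta> / (b * K)"
    using convergent_Cauchy[OF conv] unfolding Cauchy_def dist_norm by (meson order_refl)
  have "\<exists>X\<in>S. norm X \<le> r \<and> matexp X = matexp (Bt B (t k - t N))" if "k \<ge> N" for k
  proof (rule log)
    show "matexp (Bt B (t k - t N)) \<in> S"
      using Bt_S matexp_in_centralizer unfolding S_def by blast
    have "matexp (Bt B (t k - t N)) = matexp (Bt B (t k)) ** matexp (- Bt B (t N))"
      using matexp_add[OF Bt_commute[OF comm, of "t k" "- t N"]] by simp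
    then have "matexp (Bt B (t k - t N)) - mat 1
        = (matexp (Bt B (t k)) - matexp (Bt B (t N))) ** matexp (- Bt B (t N))"
      by (simp add: matrix_diff_left matexp_minus)
    then have "norm (matexp (Bt B (t k - t N)) - mat 1)
        \<le> norm (matexp (Bt B (t k)) - matexp (Bt B (t N))) * norm (matexp (- Bt B (t N))) * K"
      using K(2) by simp
    also have "\<dots> \<le> norm (matexp (Bt B (t k)) - matexp (Bt B (t N))) * b * K"
      using b K(1) by (intro mult_right_mono mult_left_mono) auto
    also have "\<dots> < \<delta>"
      using N[OF that] b(1) K(1) by (simp add: pos_less_divide_eq mult.assoc)
    finally show "norm (matexp (Bt B (t k - t N)) - mat 1) < \<delta>" .
  qed
  then obtain X where X: "\<And>k. k \<ge> N \<Longrightarrow> X k \<in> S" "\<And>k. k \<ge> N \<Longrightarrow> norm (X k) \<le> r"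
      "\<And>k. k \<ge> N \<Longrightarrow> matexp (X k) = matexp (Bt B (t k - t N))"
    by metis
  define V where "V = {Y \<in> S. bounded (range (\<lambda>s. matexp (s *\<^sub>R Y)))}"
  have sub_V: "subspace V" unfolding V_def S_def
    by (rule subspace_bounded_matexp) (use S_C in \<open>simp add: S_def\<close>)
  have in_V: "(1 / norm (t k)) *\<^sub>R (Bt B (t k - t N) - X k) \<in> V" if k: "k \<ge> N" for k
  proof (rule subspace_scale[OF sub_V])
    have "Bt B (t k - t N) ** X k = X k ** Bt B (t k - t N)"
      using X(1)[OF k] Bt_C unfolding S_def centralizer_def by (metis (mono_tags, lifting) mem_Collect_eq)
    then have "matexp (Bt B (t k - t N) + (- X k)) = matexp (X k) ** matexp (- X k)"
      using X(3)[OF k] by (subst matexp_add) (simp_all del: Bt_simps add: matrix_minus_left matrix_minus_right)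
    then have "matexp (Bt B (t k - t N) - X k) = mat 1" by (simp add: matexp_minus)
    moreover have "Bt B (t k - t N) - X k \<in> S"
      using subspace_diff[OF subspace_centralizer] Bt_S X(1)[OF k] unfolding S_def by blast
    ultimately show "Bt B (t k - t N) - X k \<in> V"
      using matexp_eq_one_imp_bounded unfolding V_def by blast
  qed
  have inv0: "(\<lambda>k. 1 / norm (t k)) \<longlonglongrightarrow> 0"
    using tendsto_inverse_0_at_top[OF inf] by (simp add: inverse_eq_divide)
  have lim1: "(\<lambda>k. Bt B ((1 / norm (t k)) *\<^sub>R t k)) \<longlonglongrightarrow> Bt B u"
    by (rule bounded_linear.tendsto[OF bounded_linear_Bt dir])
  have lim2: "(\<lambda>k. (1 / norm (t k)) *\<^sub>R (Bt B (t N) + X k)) \<longlonglongrightarrow> 0"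
  proof (rule Lim_null_comparison)
    show "\<forall>\<^sub>F k in sequentially. norm ((1 / norm (t k)) *\<^sub>R (Bt B (t N) + X k))
            \<le> (1 / norm (t k)) * (norm (Bt B (t N)) + r)"
      unfolding eventually_sequentially
    proof (intro exI[of _ N] allI impI)
      fix k assume "N \<le> k"
      then have "norm (Bt B (t N) + X k) \<le> norm (Bt B (t N)) + r"
        using norm_triangle_ineq[of "Bt B (t N)" "X k"] X(2)[of k] by linarith
      then show "norm ((1 / norm (t k)) *\<^sub>R (Bt B (t N) + X k))
            \<le> (1 / norm (t k)) * (norm (Bt B (t N)) + r)"
        by (simp add: divide_right_mono)
    qed
    show "(\<lambda>k. (1 / norm (t k)) * (norm (Bt B (t N)) + r)) \<longlonglongrightarrow> 0"
      using tendsto_mult_left_zero[OF inv0] .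
  qed
  have eq: "Bt B ((1 / norm (t k)) *\<^sub>R t k) - (1 / norm (t k)) *\<^sub>R (Bt B (t N) + X k)
      = (1 / norm (t k)) *\<^sub>R (Bt B (t k - t N) - X k)" for k
    by (simp add: algebra_simps)
  have lim: "(\<lambda>k. (1 / norm (t k)) *\<^sub>R (Bt B (t k - t N) - X k)) \<longlonglongrightarrow> Bt B u"
    using tendsto_diff[OF lim1 lim2] unfolding eq by simp
  have "\<forall>\<^sub>F k in sequentially. (1 / norm (t k)) *\<^sub>R (Bt B (t k - t N) - X k) \<in> V"
    using in_V eventually_sequentially by blast
  from Lim_in_closed_set[OF closed_subspace[OF sub_V] this sequentially_bot lim]
  have "Bt B u \<in> V" .
  then show ?thesis by (simp add: V_def)
qed

text \<open>
  The form in which condition (M2) is used: no nonzero \<open>u\<close> gives a bounded one-parameter group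
  \<open>s \<mapsto> (exp (s * pt p u), matexp (s *\<^sub>R Bt B u))\<close>. Boundedness of the scalar part means \<open>pt p u = 0\<close>.
\<close>

definition no_bounded_direction :: "real^2 \<Rightarrow> (real^'n^'n)^2 \<Rightarrow> bool" where
  "no_bounded_direction p B \<longleftrightarrow>
     (\<forall>u. u \<noteq> 0 \<longrightarrow> pt p u = 0 \<longrightarrow> \<not> bounded (range (\<lambda>s. matexp (s *\<^sub>R Bt B u))))"

lemma matexp_Bt_proper:
  fixes B :: "(real^'n^'n)^2" and t :: "nat \<Rightarrow> real^2"
  assumes comm: "B $ 1 ** B $ 2 = B $ 2 ** B $ 1"
    and dir: "no_bounded_direction p B"
    and bp: "bounded (range (\<lambda>k. pt p (t k)))"
    and b1: "bounded (range (\<lambda>k. matexp (Bt B (t k))))"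
    and b2: "bounded (range (\<lambda>k. matexp (- Bt B (t k))))"
  shows "bounded (range t)"
proof (rule ccontr)
  assume "\<not> bounded (range t)"
  then have "\<forall>k. \<exists>n. norm (t n) > real (Suc k)"
    unfolding bounded_iff by (auto simp: not_le)
  then obtain n where n: "\<And>k. norm (t (n k)) > real (Suc k)" by metis
  define v where "v k = ((1 / norm (t (n k))) *\<^sub>R t (n k), matexp (Bt B (t (n k))))" for k
  obtain c where c: "\<And>k. norm (matexp (Bt B (t k))) \<le> c" using b1 unfolding bounded_iff by auto
  have "norm (v k) \<le> 1 + c" for k
  proof -
    have "norm ((1 / norm (t (n k))) *\<^sub>R t (n k)) \<le> 1" using n[of k] by simp
    then show ?thesis
      unfolding v_def using norm_Pair_le[of "(1 / norm (t (n k))) *\<^sub>R t (n k)" "matexp (Bt B (t (n k)))"]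
        c[of "n k"] by linarith
  qed
  then have "bounded (range v)" by (auto simp: bounded_iff)
  then obtain w f where f: "strict_mono f" and "(v \<circ> f) \<longlonglongrightarrow> w"
    using bounded_imp_convergent_subsequence by blast
  then have lim1: "(\<lambda>k. (1 / norm (t (n (f k)))) *\<^sub>R t (n (f k))) \<longlonglongrightarrow> fst w"
    and lim2: "(\<lambda>k. matexp (Bt B (t (n (f k))))) \<longlonglongrightarrow> snd w"
    using tendsto_fst[of "v \<circ> f" w] tendsto_snd[of "v \<circ> f" w] by (simp_all add: v_def o_def)
  define t' where "t' k = t (n (f k))" for k
  have t'_gt: "norm (t' k) > real k" for k
    using n[of "f k"] seq_suble[OF f, of k] by (simp add: t'_def)
  have inf: "filterlim (\<lambda>k. norm (t' k)) at_top sequentially"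
    by (rule filterlim_at_top_mono[OF filterlim_real_sequentially])
      (use t'_gt in \<open>auto intro!: always_eventually less_imp_le\<close>)
  have bounded: "bounded (range (\<lambda>s. matexp (s *\<^sub>R Bt B (fst w))))"
  proof (rule bounded_matexp_limit_direction[OF comm inf])
    show "convergent (\<lambda>k. matexp (Bt B (t' k)))"
      using lim2 unfolding t'_def by (rule convergentI)
    show "bounded (range (\<lambda>k. matexp (- Bt B (t' k))))"
      by (rule bounded_subset[OF b2]) (auto simp: t'_def)
    show "(\<lambda>k. (1 / norm (t' k)) *\<^sub>R t' k) \<longlonglongrightarrow> fst w" using lim1 by (simp add: t'_def)
  qed
  have "(\<lambda>k. norm ((1 / norm (t' k)) *\<^sub>R t' k)) \<longlonglongrightarrow> norm (fst w)"
    unfolding t'_def by (intro tendsto_norm lim1)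
  moreover have "norm ((1 / norm (t' k)) *\<^sub>R t' k) = 1" for k
    using t'_gt[of k] by auto
  ultimately have "norm (fst w) = 1" by (simp add: LIMSEQ_const_iff)
  then have "fst w \<noteq> 0" by auto
  moreover have "pt p (fst w) = 0"
  proof -
    obtain d where d: "\<And>k. norm (pt p (t k)) \<le> d" using bp unfolding bounded_iff by auto
    have "(\<lambda>k. pt p ((1 / norm (t' k)) *\<^sub>R t' k)) \<longlonglongrightarrow> pt p (fst w)"
      unfolding t'_def by (rule bounded_linear.tendsto[OF bounded_linear_pt lim1])
    moreover have "(\<lambda>k. pt p ((1 / norm (t' k)) *\<^sub>R t' k)) \<longlonglongrightarrow> 0"
    proof (rule Lim_null_comparison)
      show "\<forall>\<^sub>F k in sequentially. norm (pt p ((1 / norm (t' k)) *\<^sub>R t' k)) \<le> inverse (norm (t' k)) * d"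
      proof (intro always_eventually allI)
        fix k
        have "inverse (norm (t' k)) * norm (pt p (t' k)) \<le> inverse (norm (t' k)) * d"
          by (rule mult_left_mono) (simp_all add: t'_def d[unfolded real_norm_def])
        then show "norm (pt p ((1 / norm (t' k)) *\<^sub>R t' k)) \<le> inverse (norm (t' k)) * d"
          by (simp add: divide_inverse abs_mult)
      qed
      show "(\<lambda>k. inverse (norm (t' k)) * d) \<longlonglongrightarrow> 0"
        using tendsto_mult_left_zero[OF tendsto_inverse_0_at_top[OF inf]] .
    qed
    ultimately show ?thesis using LIMSEQ_unique by blast
  qed
  ultimately show False using dir bounded unfolding no_bounded_direction_def by blast
qed

lemma matexp_Bt_injective:
  assumes "no_bounded_direction p B" "B $ 1 ** B $ 2 = B $ 2 ** B $ 1"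
    "pt p s = pt p t" "matexp (Bt B s) = matexp (Bt B t)"
  shows "s = t"
proof -
  have "matexp (Bt B (s - t)) = matexp (Bt B s) ** matexp (- Bt B t)"
    using matexp_add[OF Bt_commute[OF assms(2), of s "- t"]] by simp
  then have "matexp (Bt B (s - t)) = mat 1" by (simp only: assms(4) matexp_minus)
  then have "bounded (range (\<lambda>r. matexp (r *\<^sub>R Bt B (s - t))))"
    by (rule matexp_eq_one_imp_bounded)
  moreover have "pt p (s - t) = 0" using assms(3) by simp
  ultimately have "s - t = 0"
    using assms(1) unfolding no_bounded_direction_def by blast
  then show ?thesis by simp
qed

section \<open>Block matrices\<close>

lemma sum_UNIV_Plus:
  "(\<Sum>i\<in>(UNIV :: ('a::finite + 'b::finite) set). f i) = (\<Sum>a\<in>UNIV. f (Inl a)) + (\<Sum>b\<in>UNIV. f (Inr b))"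
  by (simp add: UNIV_Plus_UNIV[symmetric] sum.Plus del: UNIV_Plus_UNIV)

lemma block_nth [simp]:
  "block P Q R S $ Inl a $ Inl c = P $ a $ c" "block P Q R S $ Inl a $ Inr d = Q $ a $ d"
  "block P Q R S $ Inr b $ Inl c = R $ b $ c" "block P Q R S $ Inr b $ Inr d = S $ b $ d"
  by (simp_all add: block_def)

lemma matrix_eq_blockwise:
  fixes A B :: "real^('c::finite + 'd::finite)^('a::finite + 'b::finite)"
  shows "A = B \<longleftrightarrow> (\<forall>a c. A $ Inl a $ Inl c = B $ Inl a $ Inl c) \<and> (\<forall>a d. A $ Inl a $ Inr d = B $ Inl a $ Inr d)
     \<and> (\<forall>b c. A $ Inr b $ Inl c = B $ Inr b $ Inl c) \<and> (\<forall>b d. A $ Inr b $ Inr d = B $ Inr b $ Inr d)"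
  unfolding vec_eq_iff by (metis sumE)

lemma block_eq_iff:
  "block P Q R S = block P' Q' R' S' \<longleftrightarrow> P = P' \<and> Q = Q' \<and> R = R' \<and> S = S'"
  by (auto simp: matrix_eq_blockwise vec_eq_iff)

lemma block_mult:
  "block P Q R S ** block P' Q' R' S' =
     block (P ** P' + Q ** R') (P ** Q' + Q ** S') (R ** P' + S ** R') (R ** Q' + S ** S')"
  by (simp add: matrix_eq_blockwise matrix_matrix_mult_def sum_UNIV_Plus)

lemma block_add:
  "block P Q R S + block P' Q' R' S' = block (P + P') (Q + Q') (R + R') (S + S')"
  by (simp add: matrix_eq_blockwise)

lemma block_scaleR: "c *\<^sub>R block P Q R S = block (c *\<^sub>R P) (c *\<^sub>R Q) (c *\<^sub>R R) (c *\<^sub>R S)"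
  by (simp add: matrix_eq_blockwise)

lemma block_minus: "- block P Q R S = block (- P) (- Q) (- R) (- S)"
  by (simp add: matrix_eq_blockwise)

lemma block_one: "block (mat 1) 0 0 (mat 1) = mat 1"
  by (simp add: matrix_eq_blockwise mat_def)

lemma transpose_block:
  "transpose (block P Q R S) = block (transpose P) (transpose R) (transpose Q) (transpose S)"
  by (simp add: matrix_eq_blockwise transpose_def)

lemma continuous_on_block [continuous_intros]:
  assumes "continuous_on X P" "continuous_on X Q" "continuous_on X R" "continuous_on X S"
  shows "continuous_on X (\<lambda>x. block (P x) (Q x) (R x) (S x))"
proof -
  have "continuous_on X (\<lambda>x. block (P x) (Q x) (R x) (S x) $ i $ j)" for i j
    by (cases i; cases j) (auto intro!: continuous_intros assms)
  then have "continuous_on X (\<lambda>x. \<chi> i j. block (P x) (Q x) (R x) (S x) $ i $ j)"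
    by (intro continuous_on_vec_lambda)
  then show ?thesis by simp
qed

text \<open>Blocks as functions of the matrix, so that bounds and limits pass to them.\<close>

definition upper_left :: "real^('c::finite + 'd::finite)^('a::finite + 'b::finite) \<Rightarrow> real^'c^'a" where
  "upper_left A = (\<chi> i j. A $ Inl i $ Inl j)"
definition lower_left :: "real^('c::finite + 'd::finite)^('a::finite + 'b::finite) \<Rightarrow> real^'c^'b" where
  "lower_left A = (\<chi> i j. A $ Inr i $ Inl j)"
definition lower_right :: "real^('c::finite + 'd::finite)^('a::finite + 'b::finite) \<Rightarrow> real^'d^'b" where
  "lower_right A = (\<chi> i j. A $ Inr i $ Inr j)"

lemma blocks_block [simp]:
  "upper_left (block P Q R S) = P"
  "lower_left (block P Q R S) = R" "lower_right (block P Q R S) = S"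
  by (simp_all add: upper_left_def lower_left_def lower_right_def vec_eq_iff)

lemma bounded_linear_blocks:
  "bounded_linear upper_left"
  "bounded_linear lower_left" "bounded_linear lower_right"
  by (auto intro!: linearI simp: linear_conv_bounded_linear[symmetric] vec_eq_iff
      upper_left_def lower_left_def lower_right_def)

text \<open>
  The block matrix with corner \<open>a\<close>, the rest of the first row \<open>v\<close>, the rest of the first column \<open>w\<close>
  and lower right block \<open>D\<close>. All matrices of size \<open>n + 1\<close> in the theorem have this form, with vectors
  in place of one-row and one-column matrices.
\<close>

definition bordered :: "real \<Rightarrow> real^'n \<Rightarrow> real^'n \<Rightarrow> real^'n^'n \<Rightarrow> real^(1 + 'n::finite)^(1 + 'n)" where
  "bordered a v w D = block (mat a) (rowvector v) (columnvector w) D"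

text \<open>The vector with first entry \<open>z\<close> followed by the entries of \<open>x\<close>.\<close>

definition cons_vec :: "real \<Rightarrow> real^'n \<Rightarrow> real^(1 + 'n::finite)" where
  "cons_vec z x = (\<chi> i. case i of Inl _ \<Rightarrow> z | Inr j \<Rightarrow> x $ j)"

lemma bordered_nth [simp]:
  "bordered a v w D $ Inl i $ Inl j = a" "bordered a v w D $ Inl i $ Inr l = v $ l"
  "bordered a v w D $ Inr k $ Inl j = w $ k" "bordered a v w D $ Inr k $ Inr l = D $ k $ l"
  by (simp_all add: bordered_def mat_def rowvector_def columnvector_def num1_eq_iff)

lemma cons_vec_nth [simp]: "cons_vec z x $ Inl i = z" "cons_vec z x $ Inr j = x $ j"
  by (simp_all add: cons_vec_def)

lemma cons_vec_eq_iff: "cons_vec z x = v \<longleftrightarrow> v $ Inl 1 = z \<and> (\<forall>j. v $ Inr j = x $ j)"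
  unfolding vec_eq_iff by (metis (full_types) cons_vec_nth num1_eq1 sumE)

lemma cons_vec_add: "cons_vec z x + cons_vec z' x' = cons_vec (z + z') (x + x')"
  unfolding vec_eq_iff by (auto simp: cons_vec_def split: sum.split)

lemma bordered_eq_iff:
  "bordered a v w D = bordered a' v' w' D' \<longleftrightarrow> a = a' \<and> v = v' \<and> w = w' \<and> D = D'"
  by (auto simp: matrix_eq_blockwise vec_eq_iff)

lemma bordered_mult:
  fixes D D' :: "real^'n^'n"
  shows
  "bordered a v w D ** bordered a' v' w' D' =
     bordered (a * a' + v \<bullet> w') (a *\<^sub>R v' + transpose D' *v v) (a' *\<^sub>R w + D *v w')
       ((columnvector w :: real^1^'n) ** rowvector v' + D ** D')"
  by (simp add: matrix_eq_blockwise matrix_matrix_mult_def matrix_vector_mult_def transpose_def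
      sum_UNIV_Plus inner_vec_def rowvector_def columnvector_def mult.commute)

lemma rowvector_0 [simp]: "rowvector 0 = 0" and columnvector_0 [simp]: "columnvector 0 = 0"
  by (simp_all add: rowvector_def columnvector_def vec_eq_iff)

lemma transpose_0 [simp]: "transpose (0 :: real^'n^'m) = 0"
  by (simp add: transpose_def vec_eq_iff)

lemma transpose_bordered: "transpose (bordered a v w D) = bordered a w v (transpose D)"
  by (simp add: matrix_eq_blockwise transpose_def)

lemma bordered_one: "bordered 1 0 0 (mat 1) = mat 1"
  by (simp add: matrix_eq_blockwise mat_def)

lemma bordered_mult_cons_vec:
  "bordered a v w D *v cons_vec z x = cons_vec (a * z + v \<bullet> x) (z *\<^sub>R w + D *v x)"
  by (rule sym) (simp add: cons_vec_eq_iff matrix_vector_mult_def sum_UNIV_Plus inner_vec_def mult.commute)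

lemma continuous_on_bordered [continuous_intros]:
  assumes "continuous_on X a" "continuous_on X v" "continuous_on X w" "continuous_on X D"
  shows "continuous_on X (\<lambda>x. bordered (a x) (v x) (w x) (D x))"
  unfolding bordered_def mat_def rowvector_def columnvector_def
  by (intro continuous_on_block continuous_on_vec_lambda assms)
    (auto intro!: continuous_intros assms simp: num1_eq_iff)

lemma continuous_on_cons_vec [continuous_intros]:
  assumes "continuous_on X z" "continuous_on X v"
  shows "continuous_on X (\<lambda>x. cons_vec (z x) (v x))"
proof -
  have "continuous_on X (\<lambda>x. case i of Inl _ \<Rightarrow> z x | Inr j \<Rightarrow> v x $ j)" for i :: "1 + 'b"
    by (cases i) (auto intro!: continuous_intros assms)
  then show ?thesis
    unfolding cons_vec_def by (intro continuous_on_vec_lambda)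
qed

text \<open>The parts of a bordered matrix and of an extended vector, again as bounded linear maps.\<close>

definition corner :: "real^(1 + 'n::finite)^(1 + 'n) \<Rightarrow> real" where
  "corner A = A $ Inl 1 $ Inl 1"
definition top_row :: "real^(1 + 'n::finite)^(1 + 'n) \<Rightarrow> real^'n" where
  "top_row A = (\<chi> j. A $ Inl 1 $ Inr j)"
definition left_column :: "real^(1 + 'n::finite)^(1 + 'n) \<Rightarrow> real^'n" where
  "left_column A = (\<chi> i. A $ Inr i $ Inl 1)"
definition vec_head :: "real^(1 + 'n::finite) \<Rightarrow> real" where
  "vec_head v = v $ Inl 1"
definition vec_tail :: "real^(1 + 'n::finite) \<Rightarrow> real^'n" where
  "vec_tail v = (\<chi> j. v $ Inr j)"

lemma border_parts [simp]:
  "corner (bordered a v w D) = a" "top_row (bordered a v w D) = v"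
  "left_column (bordered a v w D) = w" "lower_right (bordered a v w D) = D"
  "vec_head (cons_vec z x) = z" "vec_tail (cons_vec z x) = x"
  by (simp_all add: corner_def top_row_def left_column_def lower_right_def vec_head_def
      vec_tail_def vec_eq_iff)

lemma cons_vec_head_tail: "cons_vec (vec_head v) (vec_tail v) = v"
  by (simp add: cons_vec_eq_iff vec_head_def vec_tail_def)

lemma bounded_linear_border_parts:
  "bounded_linear corner" "bounded_linear top_row" "bounded_linear left_column"
  "bounded_linear vec_head" "bounded_linear vec_tail"
  by (auto intro!: linearI simp: linear_conv_bounded_linear[symmetric] vec_eq_iff
      corner_def top_row_def left_column_def vec_head_def vec_tail_def)

text \<open>
  If \<open>u\<close> were a bounded direction, \<open>Bt B u\<close> would be similar to a skew-symmetric matrix, and so would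
  be the element of the span of \<open>Mk p B 1\<close> and \<open>Mk p B 2\<close> with coordinates \<open>u\<close>, as \<open>pt p u = 0\<close>.
\<close>

lemma no_bounded_direction_if_not_similar_skew:
  fixes B :: "(real^'n^'n)^2"
  assumes M1: "Mk p B 1 \<noteq> Mk p B 2" "independent {Mk p B 1, Mk p B 2}"
    and M2: "\<not> (\<exists>X \<in> span {Mk p B 1, Mk p B 2}. X \<noteq> 0 \<and>
                 (\<exists>S. skew_symmetric S \<and> similar_matrix X S))"
  shows "no_bounded_direction p B"
  unfolding no_bounded_direction_def
proof (intro allI impI notI)
  fix u :: "real^2"
  assume u: "u \<noteq> 0" "pt p u = 0" "bounded (range (\<lambda>s. matexp (s *\<^sub>R Bt B u)))"
  obtain S where S: "skew_symmetric S" "similar_matrix (Bt B u) S"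
    using bounded_matexp_imp_similar_skew[OF u(3)] by blast
  obtain P where P: "invertible P" "Bt B u = P ** S ** matrix_inv P"
    using S(2) unfolding similar_matrix_def by blast
  define X where "X = u $ 1 *\<^sub>R Mk p B 1 + u $ 2 *\<^sub>R Mk p B 2"
  have X_eq: "X = block (mat (pt p u)) 0 0 (block (Bt B u) 0 0 0)"
    by (simp add: X_def Mk_def block_add block_scaleR block_eq_iff pt_def Bt_def)
      (simp add: mat_def vec_eq_iff mult.commute)
  have "X \<in> span {Mk p B 1, Mk p B 2}"
    unfolding X_def by (intro span_add span_scale span_base) auto
  moreover have "X \<noteq> 0"
  proof
    assume "X = 0"
    have "\<exists>c. (\<exists>x\<in>{Mk p B 1, Mk p B 2}. c x \<noteq> 0) \<and> (\<Sum>x\<in>{Mk p B 1, Mk p B 2}. c x *\<^sub>R x) = 0"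
    proof (intro exI conjI)
      show "\<exists>x\<in>{Mk p B 1, Mk p B 2}. (\<lambda>x. if x = Mk p B 1 then u $ 1 else u $ 2) x \<noteq> 0"
        using u(1) M1(1) by (auto simp: vec_eq_iff forall_2)
      show "(\<Sum>x\<in>{Mk p B 1, Mk p B 2}. (\<lambda>x. if x = Mk p B 1 then u $ 1 else u $ 2) x *\<^sub>R x) = 0"
        using \<open>X = 0\<close> M1(1) by (simp add: X_def)
    qed
    then have "dependent {Mk p B 1, Mk p B 2}"
      by (subst dependent_finite) auto
    then show False using M1(2) by simp
  qed
  moreover have "skew_symmetric (block (0 :: real^1^1) 0 0 (block S 0 0 (0 :: real^1^1)))"
    using S(1) by (simp add: skew_symmetric_def transpose_block block_minus block_eq_iff)
  moreover have "similar_matrix X (block (0 :: real^1^1) 0 0 (block S 0 0 (0 :: real^1^1)))"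
  proof -
    define R where "R = block (mat 1 :: real^1^1) 0 0 (block P 0 0 (mat 1 :: real^1^1))"
    define R' where "R' = block (mat 1 :: real^1^1) 0 0 (block (matrix_inv P) 0 0 (mat 1 :: real^1^1))"
    have PP: "matrix_inv P ** P = mat 1" "P ** matrix_inv P = mat 1"
      using P(1) unfolding invertible_def by (metis matrix_inv_eqI)+
    have RR: "R' ** R = mat 1" "R ** R' = mat 1"
      by (simp_all add: R_def R'_def block_mult PP block_one)
    have "X = R ** block (0 :: real^1^1) 0 0 (block S 0 0 (0 :: real^1^1)) ** matrix_inv R"
      unfolding matrix_inv_eqI[OF RR(1)]
      by (simp add: X_eq u(2) P(2) R_def R'_def block_mult block_eq_iff)
    moreover have "invertible R" using RR by (auto simp: invertible_def)
    ultimately show ?thesis unfolding similar_matrix_def by blast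
  qed
  ultimately show False using M2 by blast
qed

section \<open>Topological groups\<close>

text \<open>
  A homeomorphism that respects products carries the structure of a topological group over to its
  target; the group axioms of the target are part of the conclusion.
\<close>

lemma topgroup_isomorphism_transport:
  assumes G: "topological_group G S" and homeo: "homeomorphic_map S T f"
    and carrier: "topspace T = carrier H"
    and mult: "\<And>x y. x \<in> carrier G \<Longrightarrow> y \<in> carrier G \<Longrightarrow> f (x \<otimes>\<^bsub>G\<^esub> y) = f x \<otimes>\<^bsub>H\<^esub> f y"
    and one: "f \<one>\<^bsub>G\<^esub> = \<one>\<^bsub>H\<^esub>"
  shows "topgroup_isomorphism G S H T f"
proof -
  interpret G: group G using G by (simp add: topological_group_def)
  have top_S: "topspace S = carrier G" using G by (simp add: topological_group_def)
  obtain g where maps: "homeomorphic_maps S T f g" using homeo homeomorphic_map_maps by blast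
  have gf: "\<And>x. x \<in> carrier G \<Longrightarrow> g (f x) = x" and fg: "\<And>y. y \<in> carrier H \<Longrightarrow> f (g y) = y"
    and cf: "continuous_map S T f" and cg: "continuous_map T S g"
    using maps by (auto simp: homeomorphic_maps_def top_S carrier)
  have fH: "\<And>x. x \<in> carrier G \<Longrightarrow> f x \<in> carrier H" and gG: "\<And>y. y \<in> carrier H \<Longrightarrow> g y \<in> carrier G"
    using cf cg by (auto simp: continuous_map_def top_S carrier)
  have mult_g: "x \<otimes>\<^bsub>H\<^esub> y = f (g x \<otimes>\<^bsub>G\<^esub> g y)" if "x \<in> carrier H" "y \<in> carrier H" for x y
    using that by (simp add: mult gG fg)
  have "group H"
  proof (rule groupI)
    fix x y assume "x \<in> carrier H" "y \<in> carrier H"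
    then show "x \<otimes>\<^bsub>H\<^esub> y \<in> carrier H" by (simp add: mult_g fH gG)
  next
    show "\<one>\<^bsub>H\<^esub> \<in> carrier H" using fH[OF G.one_closed] one by simp
  next
    fix x y z assume "x \<in> carrier H" "y \<in> carrier H" "z \<in> carrier H"
    then show "x \<otimes>\<^bsub>H\<^esub> y \<otimes>\<^bsub>H\<^esub> z = x \<otimes>\<^bsub>H\<^esub> (y \<otimes>\<^bsub>H\<^esub> z)"
      by (simp add: mult_g fH gG gf G.m_assoc)
  next
    fix x assume x: "x \<in> carrier H"
    then have "f (\<one>\<^bsub>G\<^esub> \<otimes>\<^bsub>G\<^esub> g x) = f \<one>\<^bsub>G\<^esub> \<otimes>\<^bsub>H\<^esub> f (g x)" by (intro mult gG) auto
    then show "\<one>\<^bsub>H\<^esub> \<otimes>\<^bsub>H\<^esub> x = x" using x by (simp add: one fg gG)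
    show "\<exists>y\<in>carrier H. y \<otimes>\<^bsub>H\<^esub> x = \<one>\<^bsub>H\<^esub>"
      using x by (intro bexI[of _ "f (inv\<^bsub>G\<^esub> g x)"]) (simp_all add: mult_g fH gG gf one)
  qed
  then interpret H: group H .
  have hom: "f \<in> hom G H" by (auto simp: hom_def fH mult)
  have inv_g: "inv\<^bsub>H\<^esub> y = f (inv\<^bsub>G\<^esub> g y)" if "y \<in> carrier H" for y
    using that by (intro H.inv_equality) (simp_all add: mult_g fH gG gf one)
  have "continuous_map (prod_topology T T) S (\<lambda>z. g (fst z) \<otimes>\<^bsub>G\<^esub> g (snd z))"
  proof -
    have "continuous_map (prod_topology T T) (prod_topology S S) (\<lambda>z. (g (fst z), g (snd z)))"
      using continuous_map_compose[OF continuous_map_fst cg] continuous_map_compose[OF continuous_map_snd cg]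
      by (auto simp: continuous_map_pairwise o_def)
    moreover have "continuous_map (prod_topology S S) S (\<lambda>(x, y). x \<otimes>\<^bsub>G\<^esub> y)"
      using G by (simp add: topological_group_def)
    ultimately show ?thesis
      by (auto dest: continuous_map_compose simp: o_def)
  qed
  from continuous_map_compose[OF this cf]
  have "continuous_map (prod_topology T T) T (\<lambda>(x, y). x \<otimes>\<^bsub>H\<^esub> y)"
    by (rule continuous_map_eq) (auto simp: carrier mult_g)
  moreover have "continuous_map T T (\<lambda>x. inv\<^bsub>H\<^esub> x)"
  proof -
    have "continuous_map S S (\<lambda>x. inv\<^bsub>G\<^esub> x)" using G by (simp add: topological_group_def)
    from continuous_map_compose[OF continuous_map_compose[OF cg this] cf] show ?thesis
      by (rule continuous_map_eq) (auto simp: carrier inv_g)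
  qed
  moreover have "bij_betw f (carrier G) (carrier H)"
    by (rule bij_betw_byWitness[where f' = g]) (auto simp: gf fg fH gG)
  ultimately show ?thesis
    using G homeo hom \<open>group H\<close> carrier
    by (simp add: topgroup_isomorphism_def topological_group_def iso_def)
qed

lemma topgroup_isomorphism_cancel:
  assumes f: "topgroup_isomorphism G S H T f" and h: "topgroup_isomorphism G S L U h"
    and k: "\<And>x. x \<in> carrier G \<Longrightarrow> k (f x) = h x"
  shows "topgroup_isomorphism H T L U k"
proof -
  have top: "topspace S = carrier G" "topspace T = carrier H" and grp: "group G" "group H"
    using f by (auto simp: topgroup_isomorphism_def topological_group_def)
  have bij: "bij_betw f (carrier G) (carrier H)" "bij_betw h (carrier G) (carrier L)"
    and mult_f: "\<And>x y. x \<in> carrier G \<Longrightarrow> y \<in> carrier G \<Longrightarrow> f (x \<otimes>\<^bsub>G\<^esub> y) = f x \<otimes>\<^bsub>H\<^esub> f y"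
    and mult_h: "\<And>x y. x \<in> carrier G \<Longrightarrow> y \<in> carrier G \<Longrightarrow> h (x \<otimes>\<^bsub>G\<^esub> y) = h x \<otimes>\<^bsub>L\<^esub> h y"
    using f h by (auto simp: topgroup_isomorphism_def iso_def hom_def)
  obtain g where maps: "homeomorphic_maps S T f g"
    using f homeomorphic_map_maps by (metis topgroup_isomorphism_def)
  have g_fg: "f (g y) = y" and g_in: "g y \<in> carrier G" if "y \<in> carrier H" for y
    using maps that by (auto simp: homeomorphic_maps_def continuous_map_def top)
  have "homeomorphic_map T S g"
    using maps homeomorphic_maps_sym homeomorphic_maps_map by metis
  note g = this g_fg g_in
  have k_g: "k y = h (g y)" if "y \<in> carrier H" for y
    using k[OF g(3)[OF that]] g(2)[OF that] by simp
  have "homeomorphic_map T U (h \<circ> g)"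
    using homeomorphic_map_compose[OF g(1)] h by (auto simp: topgroup_isomorphism_def)
  then have "homeomorphic_map T U k"
    by (rule homeomorphic_map_eq) (simp add: top k_g)
  moreover have "k \<in> hom H L"
  proof (rule homI)
    fix x y assume xy: "x \<in> carrier H" "y \<in> carrier H"
    then show "k x \<in> carrier L" using bij(2) g(3) by (auto simp: k_g bij_betw_def)
    have "x \<otimes>\<^bsub>H\<^esub> y = f (g x \<otimes>\<^bsub>G\<^esub> g y)" using xy by (simp add: mult_f g)
    then have "k (x \<otimes>\<^bsub>H\<^esub> y) = h (g x \<otimes>\<^bsub>G\<^esub> g y)"
      using xy g(3) grp(1) by (simp add: k group.subgroup_self subgroup.m_closed)
    then show "k (x \<otimes>\<^bsub>H\<^esub> y) = k x \<otimes>\<^bsub>L\<^esub> k y" using xy g(3) by (simp add: mult_h k_g)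
  qed
  moreover have "bij_betw k (carrier H) (carrier L)"
  proof -
    have "bij_betw (k \<circ> f) (carrier G) (carrier L)"
      using bij(2) by (rule bij_betw_cong[THEN iffD1, rotated]) (simp add: k)
    then show ?thesis using bij_betw_comp_iff[OF bij(1)] by blast
  qed
  ultimately show ?thesis
    using f h by (simp add: topgroup_isomorphism_def iso_def)
qed

lemma topological_group_subgroup:
  assumes "topological_group G T" "subgroup K G"
  shows "topological_group (restrict_group G K) (subtopology T K)"
proof -
  interpret G: group G using assms by (simp add: topological_group_def)
  have sub: "K \<subseteq> carrier G" using assms(2) by (rule subgroup.subset)
  have "group (restrict_group G K)"
    unfolding restrict_group_def by (rule G.subgroup_imp_group[OF assms(2)])
  moreover have "topspace (subtopology T K) = carrier (restrict_group G K)"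
    using assms(1) sub by (auto simp: topological_group_def restrict_group_def)
  moreover have "continuous_map (prod_topology (subtopology T K) (subtopology T K)) (subtopology T K)
      (\<lambda>(x, y). x \<otimes>\<^bsub>restrict_group G K\<^esub> y)"
  proof (rule continuous_map_into_subtopology)
    show "continuous_map (prod_topology (subtopology T K) (subtopology T K)) T
        (\<lambda>(x, y). x \<otimes>\<^bsub>restrict_group G K\<^esub> y)"
      unfolding subtopology_Times[symmetric] restrict_group_def
      using assms(1) by (auto intro: continuous_map_from_subtopology simp: topological_group_def)
  qed (auto simp: restrict_group_def subgroup.m_closed[OF assms(2)])
  moreover have "continuous_map (subtopology T K) (subtopology T K) (\<lambda>x. inv\<^bsub>restrict_group G K\<^esub> x)"
  proof (rule continuous_map_into_subtopology)
    have "continuous_map (subtopology T K) T (\<lambda>x. inv\<^bsub>G\<^esub> x)"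
      using assms(1) by (auto intro: continuous_map_from_subtopology simp: topological_group_def)
    then show "continuous_map (subtopology T K) T (\<lambda>x. inv\<^bsub>restrict_group G K\<^esub> x)"
      by (rule continuous_map_eq) (auto simp: restrict_group_def G.m_inv_consistent[OF assms(2)])
  qed (auto simp: restrict_group_def G.m_inv_consistent[OF assms(2)] subgroup.m_inv_closed[OF assms(2)])
  ultimately show ?thesis by (simp add: topological_group_def)
qed

text \<open>
  A continuous injection into \<open>V\<close> is a homeomorphism onto a closed subset of \<open>V\<close> if only bounded
  sequences can have images that converge in \<open>V\<close>.
\<close>

lemma closed_embedding_sequential:
  fixes f :: "'a::euclidean_space \<Rightarrow> 'b::metric_space"
  assumes cont: "continuous_on UNIV f" and inj: "inj f" and ran: "range f \<subseteq> V"
    and proper: "\<And>s l. l \<in> V \<Longrightarrow> (\<lambda>n::nat. f (s n)) \<longlonglongrightarrow> l \<Longrightarrow> bounded (range s)"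
  shows "closedin (top_of_set V) (range f)" "homeomorphic_map euclidean (top_of_set (range f)) f"
proof -
  have closed: "closedin (top_of_set V) (f ` S)" if S: "closed S" for S
    unfolding closedin_limpt
  proof (intro conjI allI impI)
    show "f ` S \<subseteq> V" using ran by auto
    fix l assume "l islimpt f ` S \<and> l \<in> V"
    then obtain y where y: "\<And>n::nat. y n \<in> f ` S" "y \<longlonglongrightarrow> l" and l: "l \<in> V"
      unfolding islimpt_sequential by blast
    have "\<forall>n. \<exists>x. x \<in> S \<and> y n = f x" using y(1) by blast
    then obtain s where s: "\<And>n. s n \<in> S" "\<And>n. y n = f (s n)" by metis
    have "y = (\<lambda>n. f (s n))" using s(2) by auto
    then have lim: "(\<lambda>n. f (s n)) \<longlonglongrightarrow> l" using y(2) by simp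
    obtain x r where r: "strict_mono r" "(s \<circ> r) \<longlonglongrightarrow> x"
      using bounded_imp_convergent_subsequence[OF proper[OF l lim]] by blast
    have "x \<in> S" using closed_sequentially[OF S _ r(2)] s(1) by simp
    have "(\<lambda>n. f ((s \<circ> r) n)) \<longlonglongrightarrow> f x"
      by (rule continuous_on_tendsto_compose[OF cont r(2)]) auto
    moreover have "(\<lambda>n. f ((s \<circ> r) n)) \<longlonglongrightarrow> l"
      using LIMSEQ_subseq_LIMSEQ[OF lim r(1)] by (simp add: o_def)
    ultimately have "l = f x" using LIMSEQ_unique by blast
    then show "l \<in> f ` S" using \<open>x \<in> S\<close> by blast
  qed
  then show "closedin (top_of_set V) (range f)" by blast
  show "homeomorphic_map euclidean (top_of_set (range f)) f"
  proof (rule bijective_closed_imp_homeomorphic_map)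
    show "continuous_map euclidean (top_of_set (range f)) f"
      using cont by (simp add: continuous_map_in_subtopology)
    show "closed_map euclidean (top_of_set (range f)) f"
      unfolding closed_map_def
      using closed closedin_subset_trans[OF closed _ ran] by auto
  qed (use inj in auto)
qed

lemma topgroup_isomorphism_closed_image:
  assumes G: "topological_group G S" and H: "topological_group H (top_of_set (carrier H))"
    and K: "closedin (top_of_set (carrier H)) K" "f ` carrier G = K"
    and homeo: "homeomorphic_map S (top_of_set K) f"
    and mult: "\<And>x y. f (x \<otimes>\<^bsub>G\<^esub> y) = f x \<otimes>\<^bsub>H\<^esub> f y"
  shows "closed_subgroup K H (top_of_set (carrier H))"
    "topgroup_isomorphism G S (restrict_group H K) (subtopology (top_of_set (carrier H)) K) f"
proof -
  have sub: "K \<subseteq> carrier H" using K(1) closedin_imp_subset by blast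
  have "group_hom G H f"
    using G H K(2) sub mult
    by (auto simp: group_hom_def group_hom_axioms_def hom_def topological_group_def)
  then interpret group_hom G H f .
  show "closed_subgroup K H (top_of_set (carrier H))"
    using img_is_subgroup H K by (simp add: closed_subgroup_def)
  have top: "subtopology (top_of_set (carrier H)) K = top_of_set K"
    using sub by (simp add: subtopology_subtopology inf_absorb2)
  show "topgroup_isomorphism G S (restrict_group H K) (subtopology (top_of_set (carrier H)) K) f"
    unfolding top
    by (rule topgroup_isomorphism_transport[OF G homeo])
      (simp_all add: restrict_group_def mult)
qed

section \<open>General linear, symplectic and affine groups\<close>

lemmas continuous_on_matrix_mult [continuous_intros] =
  bounded_bilinear.continuous_on[OF bounded_bilinear_matrix_mult]
lemmas continuous_on_matrix_vector_product [continuous_intros] =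
  bounded_bilinear.continuous_on[OF bounded_bilinear_matrix_vector_mult]
lemmas continuous_on_transpose [continuous_intros] =
  bounded_linear.continuous_on[OF bounded_linear_transpose]
lemmas continuous_on_pt [continuous_intros] = bounded_linear.continuous_on[OF bounded_linear_pt]
lemmas continuous_on_Bt [continuous_intros] = bounded_linear.continuous_on[OF bounded_linear_Bt]

lemma matrix_inv_mult:
  fixes A :: "real^'n^'n"
  assumes "invertible A"
  shows "matrix_inv A ** A = mat 1" "A ** matrix_inv A = mat 1"
  using assms unfolding invertible_def by (metis matrix_inv_eqI)+

lemma invertible_matrix_inv: "invertible A \<Longrightarrow> invertible (matrix_inv A)" for A :: "real^'n^'n"
  unfolding invertible_def[of "matrix_inv A"] using matrix_inv_mult by blast

lemma invertible_mat_1 [simp]: "invertible (mat 1 :: real^'n^'n)"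
  unfolding invertible_def by (rule exI[of _ "mat 1"]) simp

text \<open>By Cramer's rule the entries of the inverse are quotients of determinants.\<close>

lemma continuous_on_matrix_inv:
  "continuous_on {A :: real^'n^'n. invertible A} matrix_inv"
proof -
  define c where "c i j A = det (\<chi> a b. if b = i then axis j 1 $ a else A $ a $ b) / det A"
    for i j :: 'n and A :: "real^'n^'n"
  have inv: "matrix_inv A = (\<chi> i j. c i j A)" if "invertible A" for A :: "real^'n^'n"
  proof -
    have "matrix_inv A $ i $ j = c i j A" for i j
    proof -
      have "A *v (matrix_inv A *v axis j 1) = axis j 1"
        using that by (simp add: matrix_vector_mul_assoc matrix_inv_mult)
      then have "matrix_inv A *v axis j 1
          = (\<chi> k. det (\<chi> a b. if b = k then axis j 1 $ a else A $ a $ b) / det A)"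
        using that by (simp add: cramer invertible_det_nz)
      then have "(matrix_inv A *v axis j 1) $ i = c i j A" by (simp add: c_def)
      then show ?thesis by (simp add: matrix_vector_mul_component inner_axis)
    qed
    then show ?thesis by (simp add: vec_eq_iff)
  qed
  have cont_det: "continuous_on X (\<lambda>A. det (f A))" if "\<And>i j. continuous_on X (\<lambda>A. f A $ i $ j)"
    for X and f :: "real^'n^'n \<Rightarrow> real^'n^'n"
    unfolding det_def by (intro continuous_intros that)
  have "continuous_on {A. invertible A} (\<lambda>A. \<chi> i j. c i j A)"
    unfolding c_def
  proof (intro continuous_on_vec_lambda continuous_on_divide cont_det)
    fix i j k l :: 'n
    show "continuous_on {A. invertible A}
      (\<lambda>A :: real^'n^'n. (\<chi> a b. if b = i then axis j 1 $ a else A $ a $ b) $ k $ l)"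
      by (cases "l = i") (auto intro!: continuous_intros)
  qed (auto intro!: continuous_intros simp: invertible_det_nz)
  then show ?thesis by (rule continuous_on_eq) (simp add: inv)
qed

lemma group_GL: "group (GL_group :: (real^'n^'n) monoid)"
proof (rule groupI)
  fix A :: "real^'n^'n" assume "A \<in> carrier GL_group"
  then show "\<exists>B\<in>carrier GL_group. B \<otimes>\<^bsub>GL_group\<^esub> A = \<one>\<^bsub>GL_group\<^esub>"
    by (auto simp: GL_group_def invertible_def)
qed (auto simp: GL_group_def invertible_mult matrix_mul_assoc)

lemma inv_GL: "invertible A \<Longrightarrow> inv\<^bsub>GL_group\<^esub> A = matrix_inv A"
  by (rule group.inv_equality[OF group_GL])
    (simp_all add: GL_group_def matrix_inv_mult invertible_matrix_inv)

lemma topological_group_GL: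
  "topological_group GL_group (top_of_set (carrier (GL_group :: (real^'n^'n) monoid)))"
proof -
  let ?GL = "{A :: real^'n^'n. invertible A}"
  have "continuous_on (?GL \<times> ?GL) (\<lambda>(x, y). x ** y)"
    unfolding case_prod_beta by (intro continuous_intros)
  moreover have "(\<lambda>(x, y). x ** y) \<in> ?GL \<times> ?GL \<rightarrow> ?GL" by (auto intro: invertible_mult)
  moreover have "continuous_on ?GL (\<lambda>x. inv\<^bsub>GL_group\<^esub> x)"
    using continuous_on_matrix_inv by (rule continuous_on_eq) (simp add: inv_GL)
  moreover have "(\<lambda>x. inv\<^bsub>GL_group\<^esub> x) \<in> ?GL \<rightarrow> ?GL"
    using group.inv_closed[OF group_GL] by (auto simp: GL_group_def)
  ultimately show ?thesis
    using group_GL by (simp add: topological_group_def) (simp add: GL_group_def)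
qed

lemma subgroup_Sp:
  "subgroup {A. invertible A \<and> transpose A ** sympl_J ** A = sympl_J}
     (GL_group :: (real^('m::finite + 'm)^('m + 'm)) monoid)"
proof (rule group.subgroupI[OF group_GL])
  have "mat 1 \<in> {A :: real^('m::finite + 'm)^('m + 'm). invertible A \<and> transpose A ** sympl_J ** A = sympl_J}"
    by simp
  then show "{A :: real^('m::finite + 'm)^('m + 'm). invertible A \<and> transpose A ** sympl_J ** A = sympl_J} \<noteq> {}"
    by (metis empty_iff)
  fix A B :: "real^('m::finite + 'm)^('m + 'm)"
  assume A: "A \<in> {A. invertible A \<and> transpose A ** sympl_J ** A = sympl_J}"
  have "transpose (matrix_inv A) ** transpose A = mat 1"
    using A by (simp add: matrix_transpose_mul[symmetric] matrix_inv_mult)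
  moreover have "transpose (matrix_inv A) ** (transpose A ** sympl_J ** A) ** matrix_inv A
      = (transpose (matrix_inv A) ** transpose A) ** sympl_J ** (A ** matrix_inv A)"
    by (simp only: matrix_mul_assoc)
  moreover have "transpose A ** sympl_J ** A = sympl_J" "A ** matrix_inv A = mat 1"
    using A by (simp_all add: matrix_inv_mult)
  ultimately have "transpose (matrix_inv A) ** sympl_J ** matrix_inv A = sympl_J"
    by (simp only: matrix_mul_lid matrix_mul_rid)
  then show "inv\<^bsub>GL_group\<^esub> A \<in> {A. invertible A \<and> transpose A ** sympl_J ** A = sympl_J}"
    using A by (simp add: inv_GL invertible_matrix_inv)
  assume B: "B \<in> {A. invertible A \<and> transpose A ** sympl_J ** A = sympl_J}"
  have "transpose (A ** B) ** sympl_J ** (A ** B) = transpose B ** (transpose A ** sympl_J ** A) ** B"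
    by (simp add: matrix_transpose_mul matrix_mul_assoc)
  then show "A \<otimes>\<^bsub>GL_group\<^esub> B \<in> {A. invertible A \<and> transpose A ** sympl_J ** A = sympl_J}"
    using A B by (simp add: GL_group_def invertible_mult)
qed (auto simp: GL_group_def)

lemma topological_group_Sp:
  "topological_group Sp_group (Sp_top :: (real^('m::finite + 'm)^('m + 'm)) topology)"
proof -
  have eq: "Sp_top
      = subtopology (top_of_set (carrier GL_group)) {A. invertible A \<and> transpose A ** sympl_J ** A = sympl_J}"
    by (auto simp: subtopology_subtopology Sp_group_def restrict_group_def GL_group_def intro: arg_cong)
  show ?thesis
    unfolding eq unfolding Sp_group_def
    by (rule topological_group_subgroup[OF topological_group_GL subgroup_Sp])
qed

lemma carrier_Aff: "carrier Aff_group = UNIV \<times> {A. invertible A}"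
  by (simp add: Aff_group_def semidirect_def additive_group_def GL_group_def)

lemma mult_Aff: "(v, A) \<otimes>\<^bsub>Aff_group\<^esub> (w, B) = (v + A *v w, A ** B)"
  by (simp add: Aff_group_def semidirect_def additive_group_def GL_group_def)

lemma one_Aff: "\<one>\<^bsub>Aff_group\<^esub> = (0, mat 1)"
  by (simp add: Aff_group_def semidirect_def additive_group_def GL_group_def)

lemma group_Aff: "group (Aff_group :: ((real^'m) \<times> (real^'m^'m)) monoid)"
proof (rule groupI)
  fix x :: "(real^'m) \<times> (real^'m^'m)" assume x: "x \<in> carrier Aff_group"
  obtain v A where [simp]: "x = (v, A)" by fastforce
  have "invertible A" using x by (simp add: carrier_Aff)
  then show "\<exists>y\<in>carrier Aff_group. y \<otimes>\<^bsub>Aff_group\<^esub> x = \<one>\<^bsub>Aff_group\<^esub>"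
    by (intro bexI[of _ "(- (matrix_inv A *v v), matrix_inv A)"])
      (auto simp: mult_Aff one_Aff carrier_Aff matrix_inv_mult invertible_matrix_inv)
qed (auto simp: carrier_Aff mult_Aff one_Aff invertible_mult matrix_mul_assoc matrix_vector_mul_assoc
    matrix_vector_right_distrib add.assoc)

lemma topological_group_Aff:
  "topological_group Aff_group (Aff_top :: ((real^'m) \<times> (real^'m^'m)) topology)"
proof -
  let ?C = "UNIV \<times> {A. invertible A} :: ((real^'m) \<times> (real^'m^'m)) set"
  interpret group "Aff_group :: ((real^'m) \<times> (real^'m^'m)) monoid" by (rule group_Aff)
  have mult: "(\<lambda>(x, y). x \<otimes>\<^bsub>Aff_group\<^esub> y)
      = (\<lambda>z :: ((real^'m) \<times> (real^'m^'m)) \<times> ((real^'m) \<times> (real^'m^'m)).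
          (fst (fst z) + snd (fst z) *v fst (snd z), snd (fst z) ** snd (snd z)))"
    by (auto simp: fun_eq_iff mult_Aff)
  have "continuous_on (?C \<times> ?C) (\<lambda>(x, y). x \<otimes>\<^bsub>Aff_group\<^esub> y)"
    unfolding mult by (intro continuous_intros)
  moreover have "(\<lambda>(x, y). x \<otimes>\<^bsub>Aff_group\<^esub> y) \<in> ?C \<times> ?C \<rightarrow> ?C"
    using m_closed unfolding carrier_Aff by auto
  moreover have "continuous_on ?C (\<lambda>x. inv\<^bsub>Aff_group\<^esub> x)"
  proof (rule continuous_on_eq)
    have c: "continuous_on ?C (\<lambda>x. matrix_inv (snd x))"
      by (rule continuous_on_compose2[OF continuous_on_matrix_inv]) (auto intro!: continuous_intros)
    show "continuous_on ?C (\<lambda>x. (- (matrix_inv (snd x) *v fst x), matrix_inv (snd x)))"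
      by (intro continuous_intros c)
    fix x assume "x \<in> ?C"
    then show "(- (matrix_inv (snd x) *v fst x), matrix_inv (snd x)) = inv\<^bsub>Aff_group\<^esub> x"
      by (intro inv_equality[symmetric])
        (auto simp: carrier_Aff mult_Aff one_Aff matrix_inv_mult invertible_matrix_inv)
  qed
  moreover have "(\<lambda>x. inv\<^bsub>Aff_group\<^esub> x) \<in> ?C \<rightarrow> ?C"
    using inv_closed unfolding carrier_Aff by auto
  ultimately show ?thesis
    using group_Aff by (simp add: topological_group_def carrier_Aff)
qed

section \<open>The group \<open>G\<close> and its matrices\<close>

(* Otherwise transposes acting on vectors are rewritten to products of a vector and a matrix. *)
declare transpose_matrix_vector [simp del]

lemmas matrix_vector_simps =
  bounded_bilinear.add_left[OF bounded_bilinear_matrix_vector_mult]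
  bounded_bilinear.add_right[OF bounded_bilinear_matrix_vector_mult]
  bounded_bilinear.diff_right[OF bounded_bilinear_matrix_vector_mult]
  bounded_bilinear.minus_left[OF bounded_bilinear_matrix_vector_mult]
  bounded_bilinear.minus_right[OF bounded_bilinear_matrix_vector_mult]
  bounded_bilinear.scaleR_left[OF bounded_bilinear_matrix_vector_mult]
  bounded_bilinear.scaleR_right[OF bounded_bilinear_matrix_vector_mult]

lemma matexp_Bt_add:
  assumes "B $ 1 ** B $ 2 = B $ 2 ** B $ 1"
  shows "matexp (Bt B s + Bt B t) = matexp (Bt B s) ** matexp (Bt B t)"
    "matexp (- Bt B s - Bt B t) = matexp (- Bt B t) ** matexp (- Bt B s)"
  using matexp_add[OF Bt_commute[OF assms, of s t]]
    matexp_add[OF Bt_commute[OF assms, of "- t" "- s"]] by (simp_all add: algebra_simps)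

lemma transpose_matexp_dot:
  "(transpose (matexp (- A)) *v y) \<bullet> (matexp A *v x) = y \<bullet> x"
  by (metis dot_lmul_matrix matexp_minus(2) matrix_vector_mul_assoc matrix_vector_mul_lid
      transpose_matrix_vector)

text \<open>The inverse is given explicitly, for the sake of its continuity.\<close>

lemma group_G_group:
  fixes B :: "(real^'n^'n)^2"
  assumes comm: "B $ 1 ** B $ 2 = B $ 2 ** B $ 1"
  shows "group (G_group p B)"
    "inv\<^bsub>G_group p B\<^esub> (t, x, y, z) =
       (- t, - (matexp (- Bt B t) *v x), - ((exp (- pt p t) *\<^sub>R transpose (matexp (Bt B t))) *v y),
        exp (- pt p t) * (y \<bullet> x - z))"
proof -
  have inv: "(- t, - (matexp (- Bt B t) *v x), - ((exp (- pt p t) *\<^sub>R transpose (matexp (Bt B t))) *v y),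
        exp (- pt p t) * (y \<bullet> x - z)) \<otimes>\<^bsub>G_group p B\<^esub> (t, x, y, z) = \<one>\<^bsub>G_group p B\<^esub>" for t x y z
    using transpose_matexp_dot[of "- Bt B t" y x]
    by (simp add: G_group_def scaleR_matrix_vector_assoc[symmetric] algebra_simps)
  have carrier: "h \<in> carrier (G_group p B)" for h by (simp add: G_group_def)
  show grp: "group (G_group p B)"
  proof (rule groupI)
    fix g h k assume "g \<in> carrier (G_group p B)" "h \<in> carrier (G_group p B)" "k \<in> carrier (G_group p B)"
    obtain t x y z where g: "g = (t, x, y, z)" by (metis prod_cases4)
    obtain t' x' y' z' where h: "h = (t', x', y', z')" by (metis prod_cases4)
    obtain t'' x'' y'' z'' where k: "k = (t'', x'', y'', z'')" by (metis prod_cases4)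
    show "g \<otimes>\<^bsub>G_group p B\<^esub> h \<otimes>\<^bsub>G_group p B\<^esub> k = g \<otimes>\<^bsub>G_group p B\<^esub> (h \<otimes>\<^bsub>G_group p B\<^esub> k)"
      using transpose_matexp_dot[of "Bt B t" y' "matexp (Bt B t') *v x''"]
      by (simp add: g h k G_group_def matexp_Bt_add[OF comm] exp_add matrix_transpose_mul
          matrix_vector_simps matrix_vector_mul_assoc[symmetric]
          inner_add_left inner_add_right add.assoc mult.assoc distrib_left scaleR_add_right)
  next
    fix g assume "g \<in> carrier (G_group p B)"
    show "\<one>\<^bsub>G_group p B\<^esub> \<otimes>\<^bsub>G_group p B\<^esub> g = g"
      by (cases g) (simp add: G_group_def transpose_mat)
    obtain t x y z where g: "g = (t, x, y, z)" by (metis prod_cases4)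
    show "\<exists>h\<in>carrier (G_group p B). h \<otimes>\<^bsub>G_group p B\<^esub> g = \<one>\<^bsub>G_group p B\<^esub>"
      unfolding g using inv[of t x y z] carrier by metis
  qed (simp_all add: G_group_def)
  show "inv\<^bsub>G_group p B\<^esub> (t, x, y, z) =
       (- t, - (matexp (- Bt B t) *v x), - ((exp (- pt p t) *\<^sub>R transpose (matexp (Bt B t))) *v y),
        exp (- pt p t) * (y \<bullet> x - z))"
    by (rule group.inv_equality[OF grp inv]) (simp_all add: G_group_def)
qed

lemma topological_group_G:
  fixes B :: "(real^'n^'n)^2"
  assumes comm: "B $ 1 ** B $ 2 = B $ 2 ** B $ 1"
  shows "topological_group (G_group p B) G_top"
proof -
  have "(\<lambda>(g, h). g \<otimes>\<^bsub>G_group p B\<^esub> h) = (\<lambda>(g, h).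
      (fst g + fst h, fst (snd g) + matexp (Bt B (fst g)) *v fst (snd h),
       fst (snd (snd g)) + (exp (pt p (fst g)) *\<^sub>R transpose (matexp (- Bt B (fst g)))) *v fst (snd (snd h)),
       snd (snd (snd g)) + exp (pt p (fst g)) * snd (snd (snd h))
         + fst (snd (snd g)) \<bullet> (matexp (Bt B (fst g)) *v fst (snd h))))"
    by (auto simp: G_group_def fun_eq_iff)
  then have "continuous_on UNIV (\<lambda>(g, h). g \<otimes>\<^bsub>G_group p B\<^esub> h)"
    unfolding case_prod_beta by (rule ssubst) (intro continuous_intros)
  moreover have "(\<lambda>g. inv\<^bsub>G_group p B\<^esub> g) = (\<lambda>g.
       (- fst g, - (matexp (- Bt B (fst g)) *v fst (snd g)),
        - ((exp (- pt p (fst g)) *\<^sub>R transpose (matexp (Bt B (fst g)))) *v fst (snd (snd g))),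
        exp (- pt p (fst g)) * (fst (snd (snd g)) \<bullet> fst (snd g) - snd (snd (snd g)))))"
    by (auto simp: group_G_group(2)[OF comm] fun_eq_iff)
  then have "continuous_on UNIV (\<lambda>g. inv\<^bsub>G_group p B\<^esub> g)"
    by (rule ssubst) (intro continuous_intros)
  ultimately show ?thesis
    using group_G_group(1)[OF comm] by (simp add: topological_group_def) (simp add: G_group_def)
qed

lemma m_mat_bordered: "m_mat z x = bordered (- z) (- x) (- x) 0"
  by (simp add: m_mat_def bordered_def block_eq_iff) (simp add: rowvector_def columnvector_def vec_eq_iff)

lemma a_mat_bordered:
  "a_mat p B t y = bordered (exp (- pt p t / 2)) 0 (- (1/2 * exp (- pt p t / 2)) *\<^sub>R y)
     (exp (pt p t / 2) *\<^sub>R transpose (matexp (- Bt B t)))"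
proof -
  have "a_mat p B t y = bordered 1 0 (- (1/2) *\<^sub>R y) (mat 1) **
      bordered (exp (- pt p t / 2)) 0 0 (exp (pt p t / 2) *\<^sub>R transpose (matexp (- Bt B t)))"
    by (simp add: a_mat_def bordered_def)
  then show ?thesis by (simp add: bordered_mult bordered_eq_iff)
qed

lemma h_mat_bordered:
  "h_mat p B t y = bordered (exp (pt p t)) (transpose (matexp (Bt B t)) *v y) 0 (matexp (Bt B t))"
  by (simp add: h_mat_def bordered_def block_eq_iff)
    (simp add: vec_eq_iff matrix_matrix_mult_def matrix_vector_mult_def rowvector_def transpose_def mult.commute)

text \<open>
  The matrices \<open>a(t, y)\<close> and \<open>h(t, y)\<close> multiply in the same way: the product of the indices is that of
  the components \<open>t\<close> and \<open>y\<close> in \<open>G\<close>.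
\<close>

lemma a_mat_mult:
  assumes "B $ 1 ** B $ 2 = B $ 2 ** B $ 1"
  shows "a_mat p B t y ** a_mat p B t' y' =
    a_mat p B (t + t') (y + (exp (pt p t) *\<^sub>R transpose (matexp (- Bt B t))) *v y')"
proof -
  have e: "exp ((- pt p t - pt p t') / 2) = inverse (exp (pt p t / 2)) * inverse (exp (pt p t' / 2))"
    "exp ((pt p t + pt p t') / 2) = exp (pt p t / 2) * exp (pt p t' / 2)"
    "exp (pt p t) = exp (pt p t / 2) * exp (pt p t / 2)"
    by (simp_all add: mult_exp_exp add_divide_distrib diff_divide_distrib flip: exp_minus)
  show ?thesis
    by (simp add: a_mat_bordered bordered_mult bordered_eq_iff e exp_minus matexp_Bt_add[OF assms]
        matrix_transpose_mul matrix_vector_simps matrix_scaleR_left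
        matrix_scaleR_right scaleR_add_right mult_ac)
qed

lemma h_mat_mult:
  assumes "B $ 1 ** B $ 2 = B $ 2 ** B $ 1"
  shows "h_mat p B t y ** h_mat p B t' y' =
    h_mat p B (t + t') (y + (exp (pt p t) *\<^sub>R transpose (matexp (- Bt B t))) *v y')"
proof -
  have "transpose (matexp (Bt B t)) *v (transpose (matexp (- Bt B t)) *v w) = w" for w
    by (metis matexp_minus(2) matrix_transpose_mul matrix_vector_mul_assoc matrix_vector_mul_lid transpose_mat)
  then show ?thesis
    by (simp add: h_mat_bordered bordered_mult bordered_eq_iff matexp_Bt_add[OF assms] exp_add
        matrix_transpose_mul matrix_vector_mul_assoc[symmetric] 
        matrix_vector_simps add.commute)
qed

lemma a_mat_0: "a_mat p B 0 0 = mat 1" and h_mat_0: "h_mat p B 0 0 = mat 1"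
  by (simp_all add: a_mat_bordered h_mat_bordered transpose_mat bordered_one)

lemma matrix_inv_a_mat:
  "matrix_inv (a_mat p B t y) = bordered (exp (pt p t / 2)) 0
     ((1/2 * exp (- pt p t / 2)) *\<^sub>R (transpose (matexp (Bt B t)) *v y))
     (exp (- pt p t / 2) *\<^sub>R transpose (matexp (Bt B t)))"
  and invertible_a_mat: "invertible (a_mat p B t y)"
proof -
  have t: "transpose (matexp (Bt B t)) ** transpose (matexp (- Bt B t)) = mat 1"
    by (metis matexp_minus(2) matrix_transpose_mul transpose_mat)
  have e: "exp (pt p t / 2) * exp (- pt p t / 2) = 1" by (simp add: mult_exp_exp)
  have "bordered (exp (pt p t / 2)) 0
     ((1/2 * exp (- pt p t / 2)) *\<^sub>R (transpose (matexp (Bt B t)) *v y))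
     (exp (- pt p t / 2) *\<^sub>R transpose (matexp (Bt B t))) ** a_mat p B t y
     = bordered 1 0 0 (mat 1)"
    using e by (simp add: a_mat_bordered bordered_mult bordered_eq_iff matrix_scaleR_left matrix_scaleR_right
        t matrix_vector_simps mult_ac)
  then have l: "bordered (exp (pt p t / 2)) 0
     ((1/2 * exp (- pt p t / 2)) *\<^sub>R (transpose (matexp (Bt B t)) *v y))
     (exp (- pt p t / 2) *\<^sub>R transpose (matexp (Bt B t))) ** a_mat p B t y = mat 1"
    by (simp only: bordered_one)
  then show "matrix_inv (a_mat p B t y) = bordered (exp (pt p t / 2)) 0
     ((1/2 * exp (- pt p t / 2)) *\<^sub>R (transpose (matexp (Bt B t)) *v y))
     (exp (- pt p t / 2) *\<^sub>R transpose (matexp (Bt B t)))"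
    by (rule matrix_inv_eqI)
  show "invertible (a_mat p B t y)" using l invertible_left_inverse by blast
qed

lemma matrix_inv_h_mat:
  "matrix_inv (h_mat p B t y) = bordered (exp (- pt p t)) (- exp (- pt p t) *\<^sub>R y) 0 (matexp (- Bt B t))"
  and invertible_h_mat: "invertible (h_mat p B t y)"
proof -
  have e: "exp (- pt p t) * exp (pt p t) = 1" by (simp add: mult_exp_exp)
  have "bordered (exp (- pt p t)) (- exp (- pt p t) *\<^sub>R y) 0 (matexp (- Bt B t)) ** h_mat p B t y
     = bordered 1 0 0 (mat 1)"
    using e by (simp add: h_mat_bordered bordered_mult bordered_eq_iff matexp_minus
        matrix_vector_simps)
  then have l: "bordered (exp (- pt p t)) (- exp (- pt p t) *\<^sub>R y) 0 (matexp (- Bt B t)) ** h_mat p B t y = mat 1"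
    by (simp only: bordered_one)
  then show "matrix_inv (h_mat p B t y) = bordered (exp (- pt p t)) (- exp (- pt p t) *\<^sub>R y) 0 (matexp (- Bt B t))"
    by (rule matrix_inv_eqI)
  show "invertible (h_mat p B t y)" using l invertible_left_inverse by blast
qed

text \<open>The action on \<open>M\<close> is the one by which \<open>(t, y)\<close> acts on the components \<open>z\<close> and \<open>x\<close> in \<open>G\<close>.\<close>

lemma M_action_a_mat:
  fixes B :: "(real^'n^'n)^2"
  shows
  "M_action (a_mat p B t y) (m_mat z x) =
     m_mat (exp (pt p t) * z + y \<bullet> (matexp (Bt B t) *v x)) (matexp (Bt B t) *v x)"
proof -
  have e: "exp (pt p t) = exp (pt p t / 2) * exp (pt p t / 2)"
    by (simp add: mult_exp_exp)
  have dot: "(transpose A *v u) \<bullet> v = u \<bullet> (A *v v)" "v \<bullet> (transpose A *v u) = u \<bullet> (A *v v)"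
    for A :: "real^'n^'n" and u v
    by (metis dot_lmul_matrix transpose_matrix_vector inner_commute)+
  show ?thesis
    by (simp add: M_action_def matrix_inv_a_mat m_mat_bordered transpose_bordered bordered_mult bordered_eq_iff
        transpose_scaleR matrix_vector_simps dot e exp_minus field_simps)
qed

section \<open>Closed embeddings\<close>

text \<open>
  The isomorphisms from \<open>G\<close> onto \<open>M \<rtimes> E\<close>, onto the subgroup of the affine group and onto the
  subgroup of the symplectic group. In the second one the components \<open>z\<close> and \<open>x\<close> together form the
  translation vector, with \<open>z\<close> first.
\<close>

definition G_to_ME ::
  "real^2 \<Rightarrow> (real^'n^'n)^2 \<Rightarrow> (real^2) \<times> (real^'n) \<times> (real^'n) \<times> real
    \<Rightarrow> (real^(1 + 'n::finite)^(1 + 'n)) \<times> (real^(1 + 'n)^(1 + 'n))" where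
  "G_to_ME p B = (\<lambda>(t, x, y, z). (m_mat z x, a_mat p B t y))"

definition G_to_RH ::
  "real^2 \<Rightarrow> (real^'n^'n)^2 \<Rightarrow> (real^2) \<times> (real^'n) \<times> (real^'n) \<times> real
    \<Rightarrow> (real^(1 + 'n::finite)) \<times> (real^(1 + 'n)^(1 + 'n))" where
  "G_to_RH p B = (\<lambda>(t, x, y, z). (cons_vec z x, h_mat p B t y))"

definition G_to_K ::
  "real^2 \<Rightarrow> (real^'n^'n)^2 \<Rightarrow> (real^2) \<times> (real^'n) \<times> (real^'n) \<times> real
    \<Rightarrow> real^((1 + 'n::finite) + (1 + 'n))^((1 + 'n) + (1 + 'n))" where
  "G_to_K p B = (\<lambda>(t, x, y, z). K_mat (m_mat z x) (a_mat p B t y))"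

lemma bounded_range_linear:
  assumes "bounded_linear f" "bounded (range g)"
  shows "bounded (range (\<lambda>k. f (g k)))"
  using bounded_linear_image[OF assms(2,1)] by (simp add: image_image)

lemma bounded_range_bilinear:
  assumes h: "bounded_bilinear h" and f: "bounded (range f)" and g: "bounded (range g)"
  shows "bounded (range (\<lambda>k. h (f k) (g k)))"
proof -
  obtain K where K: "K > 0" "\<And>a b. norm (h a b) \<le> norm a * norm b * K"
    using bounded_bilinear.pos_bounded[OF h] by blast
  obtain a where a: "a > 0" "\<And>k. norm (f k) \<le> a" using f unfolding bounded_pos by auto
  obtain b where b: "b > 0" "\<And>k. norm (g k) \<le> b" using g unfolding bounded_pos by auto
  have "norm (h (f k) (g k)) \<le> a * b * K" for k
  proof -
    have "norm (h (f k) (g k)) \<le> norm (f k) * norm (g k) * K" by (rule K)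
    also have "\<dots> \<le> a * b * K"
      using K(1) a(1) by (intro mult_right_mono mult_mono a b) auto
    finally show ?thesis .
  qed
  then show ?thesis unfolding bounded_iff by auto
qed

lemma bounded_range_Pair:
  assumes "bounded (range f)" "bounded (range g)"
  shows "bounded (range (\<lambda>k. (f k, g k)))"
  by (rule bounded_subset[OF bounded_Times[OF assms]]) auto

lemma bounded_range_exp_imp:
  fixes u :: "nat \<Rightarrow> real"
  assumes "bounded (range (\<lambda>k. exp (u k)))" "bounded (range (\<lambda>k. exp (- u k)))"
  shows "bounded (range u)"
proof -
  obtain a where a: "\<And>k. exp (u k) \<le> a" using assms(1) unfolding bounded_iff by auto
  obtain b where b: "\<And>k. exp (- u k) \<le> b" using assms(2) unfolding bounded_iff by auto
  have "norm (u k) \<le> a + b" for k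
    using a[of k] b[of k] exp_ge_add_one_self[of "u k"] exp_ge_add_one_self[of "- u k"]
      exp_gt_zero[of "u k"] exp_gt_zero[of "- u k"] unfolding real_norm_def by linarith
  then show ?thesis unfolding bounded_iff by auto
qed

text \<open>
  Bounds on \<open>a(t, y)\<close> and its inverse bound \<open>pt p t\<close>, then \<open>matexp (Bt B t)\<close> and its inverse, hence
  \<open>t\<close>, and finally \<open>y\<close>. The same holds for \<open>h(t, y)\<close>.
\<close>

lemma a_mat_proper:
  fixes B :: "(real^'n^'n)^2" and t :: "nat \<Rightarrow> real^2"
  assumes comm: "B $ 1 ** B $ 2 = B $ 2 ** B $ 1" and dir: "no_bounded_direction p B"
    and a: "bounded (range (\<lambda>k. a_mat p B (t k) (y k)))"
    and i: "bounded (range (\<lambda>k. matrix_inv (a_mat p B (t k) (y k))))"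
  shows "bounded (range t)" "bounded (range y)"
proof -
  have c1: "bounded (range (\<lambda>k. exp (- (pt p (t k) / 2))))"
    using bounded_range_linear[OF bounded_linear_border_parts(1) a] by (simp add: a_mat_bordered)
  have c2: "bounded (range (\<lambda>k. exp (pt p (t k) / 2)))"
    using bounded_range_linear[OF bounded_linear_border_parts(1) i] by (simp add: matrix_inv_a_mat)
  have "bounded (range (\<lambda>k. pt p (t k) / 2))" by (rule bounded_range_exp_imp[OF c2 c1])
  from bounded_range_linear[OF bounded_linear_mult_right[of 2] this]
  have p: "bounded (range (\<lambda>k. pt p (t k)))" by simp
  have ee: "exp (- (s / 2)) * exp (s / 2) = 1" "exp (s / 2) * exp (- (s / 2)) = 1" for s :: real
    by (simp_all add: mult_exp_exp)
  have "bounded (range (\<lambda>k. exp (pt p (t k) / 2) *\<^sub>R transpose (matexp (- Bt B (t k)))))"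
    using bounded_range_linear[OF bounded_linear_blocks(3) a] by (simp add: a_mat_bordered)
  from bounded_range_linear[OF bounded_linear_transpose
      bounded_range_bilinear[OF bounded_bilinear_scaleR c1 this]]
  have b2: "bounded (range (\<lambda>k. matexp (- Bt B (t k))))" by (simp add: ee)
  have "bounded (range (\<lambda>k. exp (- (pt p (t k) / 2)) *\<^sub>R transpose (matexp (Bt B (t k)))))"
    using bounded_range_linear[OF bounded_linear_blocks(3) i] by (simp add: matrix_inv_a_mat)
  from bounded_range_linear[OF bounded_linear_transpose
      bounded_range_bilinear[OF bounded_bilinear_scaleR c2 this]]
  have b1: "bounded (range (\<lambda>k. matexp (Bt B (t k))))" by (simp add: ee)
  show "bounded (range t)" by (rule matexp_Bt_proper[OF comm dir p b1 b2])
  have "bounded (range (\<lambda>k. - (1/2 * exp (- (pt p (t k) / 2))) *\<^sub>R y k))"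
    using bounded_range_linear[OF bounded_linear_border_parts(3) a] by (simp add: a_mat_bordered)
  from bounded_range_linear[OF bounded_linear_scaleR_right[of "- 2"]
      bounded_range_bilinear[OF bounded_bilinear_scaleR c2 this]]
  show "bounded (range y)" by (simp add: ee)
qed

lemma h_mat_proper:
  fixes B :: "(real^'n^'n)^2" and t :: "nat \<Rightarrow> real^2"
  assumes comm: "B $ 1 ** B $ 2 = B $ 2 ** B $ 1" and dir: "no_bounded_direction p B"
    and h: "bounded (range (\<lambda>k. h_mat p B (t k) (y k)))"
    and i: "bounded (range (\<lambda>k. matrix_inv (h_mat p B (t k) (y k))))"
  shows "bounded (range t)" "bounded (range y)"
proof -
  have c1: "bounded (range (\<lambda>k. exp (- pt p (t k))))"
    using bounded_range_linear[OF bounded_linear_border_parts(1) i] by (simp add: matrix_inv_h_mat)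
  have c2: "bounded (range (\<lambda>k. exp (pt p (t k))))"
    using bounded_range_linear[OF bounded_linear_border_parts(1) h] by (simp add: h_mat_bordered)
  have b1: "bounded (range (\<lambda>k. matexp (Bt B (t k))))"
    using bounded_range_linear[OF bounded_linear_blocks(3) h] by (simp add: h_mat_bordered)
  have b2: "bounded (range (\<lambda>k. matexp (- Bt B (t k))))"
    using bounded_range_linear[OF bounded_linear_blocks(3) i] by (simp add: matrix_inv_h_mat)
  show "bounded (range t)"
    by (rule matexp_Bt_proper[OF comm dir bounded_range_exp_imp[OF c2 c1] b1 b2])
  have "bounded (range (\<lambda>k. - exp (- pt p (t k)) *\<^sub>R y k))"
    using bounded_range_linear[OF bounded_linear_border_parts(2) i] by (simp add: matrix_inv_h_mat)
  from bounded_range_linear[OF bounded_linear_minus[OF bounded_linear_ident]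
      bounded_range_bilinear[OF bounded_bilinear_scaleR c2 this]]
  show "bounded (range y)" by (simp add: mult_exp_exp)
qed

lemma a_mat_injective:
  assumes comm: "B $ 1 ** B $ 2 = B $ 2 ** B $ 1" and dir: "no_bounded_direction p B"
    and eq: "a_mat p B t y = a_mat p B t' y'"
  shows "t = t' \<and> y = y'"
proof -
  have pt: "pt p t = pt p t'" using eq by (simp add: a_mat_bordered bordered_eq_iff)
  then have "transpose (matexp (- Bt B t)) = transpose (matexp (- Bt B t'))"
    using eq by (simp add: a_mat_bordered bordered_eq_iff)
  then have "matexp (Bt B (- t)) = matexp (Bt B (- t'))" by (metis Bt_simps(3) transpose_transpose)
  then have "- t = - t'" by (intro matexp_Bt_injective[OF dir comm]) (simp_all add: pt)
  then show ?thesis using eq pt by (simp add: a_mat_bordered bordered_eq_iff)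
qed

lemma h_mat_injective:
  assumes comm: "B $ 1 ** B $ 2 = B $ 2 ** B $ 1" and dir: "no_bounded_direction p B"
    and eq: "h_mat p B t y = h_mat p B t' y'"
  shows "t = t' \<and> y = y'"
proof -
  have t: "t = t'"
    by (rule matexp_Bt_injective[OF dir comm]) (use eq in \<open>simp_all add: h_mat_bordered bordered_eq_iff\<close>)
  have "matrix_inv (h_mat p B t y) = matrix_inv (h_mat p B t y')" using eq t by simp
  then show ?thesis using t by (simp add: matrix_inv_h_mat bordered_eq_iff)
qed

lemma m_mat_eq_iff: "m_mat z x = m_mat z' x' \<longleftrightarrow> z = z' \<and> x = x'"
  by (auto simp: m_mat_bordered bordered_eq_iff)

lemma m_mat_add: "m_mat z x + m_mat z' x' = m_mat (z + z') (x + x')"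
  by (simp add: m_mat_bordered matrix_eq_blockwise)

lemma m_mat_0: "m_mat 0 0 = 0"
  by (simp add: m_mat_bordered matrix_eq_blockwise)

lemma transpose_m_mat: "transpose (m_mat z x) = m_mat z x"
  by (simp add: m_mat_bordered transpose_bordered)

lemma m_mat_bounded:
  assumes "bounded (range (\<lambda>k. m_mat (z k) (x k)))"
  shows "bounded (range z)" "bounded (range x)"
  using bounded_range_linear[OF bounded_linear_minus[OF bounded_linear_border_parts(1)] assms]
    bounded_range_linear[OF bounded_linear_minus[OF bounded_linear_border_parts(2)] assms]
  by (simp_all add: m_mat_bordered)

lemma K_mat_mult:
  assumes "invertible a" "invertible b"
  shows "K_mat m a ** K_mat n b = K_mat (m + M_action a n) (a ** b)"
proof -
  have inv: "matrix_inv (a ** b) = matrix_inv b ** matrix_inv a"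
  proof (rule matrix_inv_eqI)
    have "matrix_inv b ** matrix_inv a ** (a ** b) = matrix_inv b ** (matrix_inv a ** a) ** b"
      by (simp only: matrix_mul_assoc)
    then show "matrix_inv b ** matrix_inv a ** (a ** b) = mat 1"
      by (simp add: matrix_inv_mult assms)
  qed
  have "M_action a n ** (a ** b) = transpose (matrix_inv a) ** n ** (matrix_inv a ** a) ** b"
    by (simp only: M_action_def matrix_mul_assoc)
  then have "M_action a n ** (a ** b) = transpose (matrix_inv a) ** (n ** b)"
    by (simp add: matrix_inv_mult assms matrix_mul_assoc)
  then show ?thesis
    by (simp add: K_mat_def block_mult block_eq_iff inv matrix_transpose_mul matrix_add_rdistrib matrix_mul_assoc)
qed

lemma K_mat_0: "K_mat 0 (mat 1 :: real^'m^'m) = mat 1"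
proof -
  have "matrix_inv (mat 1 :: real^'m^'m) = mat 1" by (rule matrix_inv_eqI) simp
  then show ?thesis by (simp add: K_mat_def block_one)
qed

lemma K_mat_symplectic:
  fixes a :: "real^'m^'m"
  assumes a: "invertible a" and m: "transpose m = m"
  shows "K_mat m a \<in> carrier Sp_group"
proof -
  have t: "transpose a ** transpose (matrix_inv a) = mat 1"
    by (metis a matrix_inv_mult(1) matrix_transpose_mul transpose_mat)
  have "K_mat (- (transpose a ** m ** a)) (matrix_inv a) ** K_mat m a = mat 1"
  proof -
    have "M_action (matrix_inv a) m = transpose a ** m ** a"
      using matrix_inv_eqI[OF matrix_inv_mult(2)[OF a]] by (simp add: M_action_def)
    then show ?thesis
      by (simp add: K_mat_mult invertible_matrix_inv a matrix_inv_mult K_mat_0)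
  qed
  then have "invertible (K_mat m a)" using invertible_left_inverse by blast
  moreover have "transpose (K_mat m a) ** sympl_J ** K_mat m a = sympl_J"
    by (simp add: K_mat_def sympl_J_def transpose_block block_mult block_eq_iff matrix_transpose_mul m t
        matrix_minus_left matrix_minus_right matrix_mul_assoc matrix_inv_mult[OF a])
  ultimately show ?thesis by (simp add: Sp_group_def restrict_group_def)
qed

lemma range_G_to_ME: "range (G_to_ME p B) = M_set \<times> E_set p B"
  by (auto simp: G_to_ME_def M_set_def E_set_def image_iff) blast+

lemma range_G_to_RH: "range (G_to_RH p B) = RH_set p B"
proof -
  have "\<exists>z x. v = cons_vec z x" for v :: "real^(1 + 'a)"
    using cons_vec_head_tail[of v] by metis
  then show ?thesis
    by (auto simp: G_to_RH_def RH_set_def H_set_def image_iff) blast+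
qed

lemma range_G_to_K: "range (G_to_K p B) = K_set p B"
  by (auto simp: G_to_K_def K_set_def M_set_def E_set_def image_iff) blast

lemma continuous_on_a_mat [continuous_intros]:
  assumes "continuous_on X t" "continuous_on X y"
  shows "continuous_on X (\<lambda>g. a_mat p B (t g) (y g))"
  unfolding a_mat_bordered by (intro continuous_intros assms) auto

lemma continuous_on_matrix_inv_a_mat [continuous_intros]:
  assumes "continuous_on X t" "continuous_on X y"
  shows "continuous_on X (\<lambda>g. matrix_inv (a_mat p B (t g) (y g)))"
  unfolding matrix_inv_a_mat by (intro continuous_intros assms) auto

lemma continuous_on_h_mat [continuous_intros]:
  assumes "continuous_on X t" "continuous_on X y"
  shows "continuous_on X (\<lambda>g. h_mat p B (t g) (y g))"
  unfolding h_mat_bordered by (intro continuous_intros assms)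

lemma continuous_on_m_mat [continuous_intros]:
  assumes "continuous_on X z" "continuous_on X x"
  shows "continuous_on X (\<lambda>g. m_mat (z g) (x g))"
  unfolding m_mat_bordered by (intro continuous_intros assms)

lemma convergent_imp_bounded_matrix_inv:
  fixes a :: "real^'m^'m"
  assumes "f \<longlonglongrightarrow> a" "invertible a" "\<And>k. invertible (f k)"
  shows "bounded (range (\<lambda>k. matrix_inv (f k)))"
proof -
  have "(\<lambda>k. matrix_inv (f k)) \<longlonglongrightarrow> matrix_inv a"
    by (rule continuous_on_tendsto_compose[OF continuous_on_matrix_inv assms(1)])
      (simp_all add: assms)
  then show ?thesis by (rule convergent_imp_bounded)
qed

lemma bounded_range_quadruple:
  fixes s :: "nat \<Rightarrow> (real^2) \<times> (real^'n) \<times> (real^'n) \<times> real"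
  assumes "bounded (range (\<lambda>k. fst (s k)))" "bounded (range (\<lambda>k. fst (snd (s k))))"
    "bounded (range (\<lambda>k. fst (snd (snd (s k)))))" "bounded (range (\<lambda>k. snd (snd (snd (s k)))))"
  shows "bounded (range s)"
  using bounded_range_Pair[OF assms(1) bounded_range_Pair[OF assms(2) bounded_range_Pair[OF assms(3,4)]]]
  by simp

lemma homeomorphic_G_to_ME:
  fixes B :: "(real^'n^'n)^2"
  assumes comm: "B $ 1 ** B $ 2 = B $ 2 ** B $ 1" and dir: "no_bounded_direction p B"
  shows "homeomorphic_map euclidean (top_of_set (M_set \<times> E_set p B)) (G_to_ME p B)"
proof -
  have "homeomorphic_map euclidean (top_of_set (range (G_to_ME p B))) (G_to_ME p B)"
  proof (rule closed_embedding_sequential(2)[where V = "UNIV \<times> {a. invertible a}"])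
    show "continuous_on UNIV (G_to_ME p B)"
      unfolding G_to_ME_def case_prod_beta by (intro continuous_intros)
    show "inj (G_to_ME p B)"
      by (rule injI) (auto simp: G_to_ME_def m_mat_eq_iff dest: a_mat_injective[OF comm dir])
    show "range (G_to_ME p B) \<subseteq> UNIV \<times> {a. invertible a}"
      by (auto simp: G_to_ME_def invertible_a_mat)
    fix s :: "nat \<Rightarrow> (real^2) \<times> (real^'n) \<times> (real^'n) \<times> real" and l
    assume l: "l \<in> UNIV \<times> {a :: real^(1 + 'n)^(1 + 'n). invertible a}"
      and lim: "(\<lambda>k. G_to_ME p B (s k)) \<longlonglongrightarrow> l"
    have m: "(\<lambda>k. m_mat (snd (snd (snd (s k)))) (fst (snd (s k)))) \<longlonglongrightarrow> fst l"
      using tendsto_fst[OF lim] by (simp add: G_to_ME_def case_prod_beta)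
    have a: "(\<lambda>k. a_mat p B (fst (s k)) (fst (snd (snd (s k))))) \<longlonglongrightarrow> snd l"
      using tendsto_snd[OF lim] by (simp add: G_to_ME_def case_prod_beta)
    \<comment> \<open>The limit of the second components is invertible, so the inverses converge too.\<close>
    have i: "bounded (range (\<lambda>k. matrix_inv (a_mat p B (fst (s k)) (fst (snd (snd (s k)))))))"
      by (rule convergent_imp_bounded_matrix_inv[OF a]) (use l invertible_a_mat in auto)
    show "bounded (range s)"
      by (rule bounded_range_quadruple m_mat_bounded[OF convergent_imp_bounded[OF m]]
          a_mat_proper[OF comm dir convergent_imp_bounded[OF a] i])+
  qed
  then show ?thesis by (simp only: range_G_to_ME)
qed

text \<open>
  The inverses of the linear parts are bounded because the limit lies in the affine group. In the
  symplectic embedding below the inverses appear as a block, so that the image is even closed in the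
  space of all matrices.
\<close>

lemma closed_embedding_G_to_RH:
  fixes B :: "(real^'n^'n)^2"
  assumes comm: "B $ 1 ** B $ 2 = B $ 2 ** B $ 1" and dir: "no_bounded_direction p B"
  shows "closedin Aff_top (RH_set p B)"
    "homeomorphic_map euclidean (top_of_set (RH_set p B)) (G_to_RH p B)"
proof -
  have cont: "continuous_on UNIV (G_to_RH p B)"
    unfolding G_to_RH_def case_prod_beta by (intro continuous_intros)
  have inj: "inj (G_to_RH p B)"
  proof (rule injI)
    fix g g' assume eq: "G_to_RH p B g = G_to_RH p B g'"
    obtain t x y z t' x' y' z' where g: "g = (t, x, y, z)" "g' = (t', x', y', z')"
      by (metis prod_cases4)
    have "cons_vec z x = cons_vec z' x'" "h_mat p B t y = h_mat p B t' y'"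
      using eq by (simp_all add: G_to_RH_def g)
    then show "g = g'"
      using h_mat_injective[OF comm dir] border_parts(5,6)[of z x] border_parts(5,6)[of z' x']
      by (metis g)
  qed
  have ran: "range (G_to_RH p B) \<subseteq> carrier Aff_group"
    by (auto simp: G_to_RH_def carrier_Aff invertible_h_mat)
  have proper: "bounded (range s)"
    if l: "l \<in> carrier Aff_group" and lim: "(\<lambda>k. G_to_RH p B (s k)) \<longlonglongrightarrow> l" for s l
  proof -
    have v: "(\<lambda>k. cons_vec (snd (snd (snd (s k)))) (fst (snd (s k)))) \<longlonglongrightarrow> fst l"
      using tendsto_fst[OF lim] by (simp add: G_to_RH_def case_prod_beta)
    have h: "(\<lambda>k. h_mat p B (fst (s k)) (fst (snd (snd (s k))))) \<longlonglongrightarrow> snd l"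
      using tendsto_snd[OF lim] by (simp add: G_to_RH_def case_prod_beta)
    have i: "bounded (range (\<lambda>k. matrix_inv (h_mat p B (fst (s k)) (fst (snd (snd (s k)))))))"
      by (rule convergent_imp_bounded_matrix_inv[OF h]) (use l invertible_h_mat in \<open>auto simp: carrier_Aff\<close>)
    have "bounded (range (\<lambda>k. snd (snd (snd (s k)))))"
      using bounded_range_linear[OF bounded_linear_border_parts(4) convergent_imp_bounded[OF v]] by simp
    moreover have "bounded (range (\<lambda>k. fst (snd (s k))))"
      using bounded_range_linear[OF bounded_linear_border_parts(5) convergent_imp_bounded[OF v]] by simp
    ultimately show ?thesis
      using bounded_range_quadruple h_mat_proper[OF comm dir convergent_imp_bounded[OF h] i] by blast
  qed
  show "closedin Aff_top (RH_set p B)"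
    using closed_embedding_sequential(1)[OF cont inj ran proper] by (simp only: range_G_to_RH)
  show "homeomorphic_map euclidean (top_of_set (RH_set p B)) (G_to_RH p B)"
    using closed_embedding_sequential(2)[OF cont inj ran proper] by (simp only: range_G_to_RH)
qed

lemma closed_embedding_G_to_K:
  fixes B :: "(real^'n^'n)^2"
  assumes comm: "B $ 1 ** B $ 2 = B $ 2 ** B $ 1" and dir: "no_bounded_direction p B"
  shows "closedin Sp_top (K_set p B)"
    "homeomorphic_map euclidean (top_of_set (K_set p B)) (G_to_K p B)"
proof -
  have cont: "continuous_on UNIV (G_to_K p B)"
    unfolding G_to_K_def case_prod_beta K_mat_def by (intro continuous_intros)
  have cancel: "m ** a_mat p B t y ** matrix_inv (a_mat p B t y) = m" for m t y
    using matrix_inv_mult(2)[OF invertible_a_mat] by (metis matrix_mul_assoc matrix_mul_rid)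
  have inj: "inj (G_to_K p B)"
  proof (rule injI)
    fix g g' assume eq: "G_to_K p B g = G_to_K p B g'"
    obtain t x y z t' x' y' z' where g: "g = (t, x, y, z)" "g' = (t', x', y', z')"
      by (metis prod_cases4)
    have a: "a_mat p B t y = a_mat p B t' y'"
      and m: "m_mat z x ** a_mat p B t y = m_mat z' x' ** a_mat p B t' y'"
      using eq unfolding G_to_K_def g K_mat_def prod.case block_eq_iff by blast+
    have "m_mat z x = m_mat z' x'" using cancel m a by metis
    then show "g = g'"
      using a_mat_injective[OF comm dir a] by (simp add: g m_mat_eq_iff)
  qed
  have ran: "range (G_to_K p B) \<subseteq> carrier Sp_group"
    by (auto simp: G_to_K_def intro!: K_mat_symplectic invertible_a_mat transpose_m_mat)
  have proper: "bounded (range s)" if lim: "(\<lambda>k. G_to_K p B (s k)) \<longlonglongrightarrow> l" for s l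
  proof -
    define m where "m k = m_mat (snd (snd (snd (s k)))) (fst (snd (s k)))" for k
    define a where "a k = a_mat p B (fst (s k)) (fst (snd (snd (s k))))" for k
    have "G_to_K p B (s k) = block (a k) 0 (m k ** a k) (transpose (matrix_inv (a k)))" for k
      by (simp add: G_to_K_def case_prod_beta K_mat_def m_def a_def)
    then have K: "bounded (range (\<lambda>k. block (a k) 0 (m k ** a k) (transpose (matrix_inv (a k)))))"
      using convergent_imp_bounded[OF lim] by simp
    have a: "bounded (range a)" using bounded_range_linear[OF bounded_linear_blocks(1) K] by simp
    have i: "bounded (range (\<lambda>k. matrix_inv (a k)))"
      using bounded_range_linear[OF bounded_linear_transpose bounded_range_linear[OF bounded_linear_blocks(3) K]]
      by simp
    have "bounded (range (\<lambda>k. m k ** a k))" using bounded_range_linear[OF bounded_linear_blocks(2) K] by simp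
    from bounded_range_bilinear[OF bounded_bilinear_matrix_mult this i]
    have m: "bounded (range m)" by (simp add: a_def cancel)
    show ?thesis
      by (rule bounded_range_quadruple m_mat_bounded[OF m[unfolded m_def]]
          a_mat_proper[OF comm dir a[unfolded a_def] i[unfolded a_def]])+
  qed
  show "closedin Sp_top (K_set p B)"
    using closed_embedding_sequential(1)[OF cont inj ran proper] by (simp only: range_G_to_K)
  show "homeomorphic_map euclidean (top_of_set (K_set p B)) (G_to_K p B)"
    using closed_embedding_sequential(2)[OF cont inj ran proper] by (simp only: range_G_to_K)
qed

lemma mult_G: "(t, x, y, z) \<otimes>\<^bsub>G_group p B\<^esub> (t', x', y', z') =
    (t + t', x + matexp (Bt B t) *v x',
     y + (exp (pt p t) *\<^sub>R transpose (matexp (- Bt B t))) *v y',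
     z + exp (pt p t) * z' + y \<bullet> (matexp (Bt B t) *v x'))"
  by (simp add: G_group_def)

lemma G_to_ME_mult:
  assumes comm: "B $ 1 ** B $ 2 = B $ 2 ** B $ 1"
  shows "G_to_ME p B (g \<otimes>\<^bsub>G_group p B\<^esub> g') = G_to_ME p B g \<otimes>\<^bsub>ME_group p B\<^esub> G_to_ME p B g'"
  by (cases g; cases g')
    (auto simp: mult_G G_to_ME_def ME_group_def semidirect_def additive_group_def restrict_group_def
      GL_group_def M_action_a_mat m_mat_add a_mat_mult[OF comm] add.assoc)

lemma G_to_RH_mult:
  assumes comm: "B $ 1 ** B $ 2 = B $ 2 ** B $ 1"
  shows "G_to_RH p B (g \<otimes>\<^bsub>G_group p B\<^esub> g') = G_to_RH p B g \<otimes>\<^bsub>Aff_group\<^esub> G_to_RH p B g'"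
proof -
  have "h_mat p B t y *v cons_vec z x
      = cons_vec (exp (pt p t) * z + y \<bullet> (matexp (Bt B t) *v x)) (matexp (Bt B t) *v x)" for t x y z
    by (simp add: h_mat_bordered bordered_mult_cons_vec)
      (metis dot_lmul_matrix transpose_matrix_vector)
  then show ?thesis
    by (cases g; cases g')
      (auto simp: mult_G G_to_RH_def mult_Aff cons_vec_add h_mat_mult[OF comm] add.assoc)
qed

lemma G_to_K_mult:
  assumes comm: "B $ 1 ** B $ 2 = B $ 2 ** B $ 1"
  shows "G_to_K p B (g \<otimes>\<^bsub>G_group p B\<^esub> g') = G_to_K p B g \<otimes>\<^bsub>Sp_group\<^esub> G_to_K p B g'"
  by (cases g; cases g')
    (auto simp: mult_G G_to_K_def Sp_group_def restrict_group_def GL_group_def K_mat_mult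
      invertible_a_mat M_action_a_mat m_mat_add a_mat_mult[OF comm] add.assoc)

theorem mainTheorem1:
  fixes p :: "real^2" and B :: "(real^'n^'n)^2"
  assumes comm: "B $ 1 ** B $ 2 = B $ 2 ** B $ 1"
    and M1: "Mk p B 1 \<noteq> Mk p B 2" "independent {Mk p B 1, Mk p B 2}"
    and M2: "\<not> (\<exists>X \<in> span {Mk p B 1, Mk p B 2}. X \<noteq> 0 \<and>
                 (\<exists>S. skew_symmetric S \<and> similar_matrix X S))"
  shows
    "topgroup_isomorphic (G_group p B) G_top (ME_group p B) (ME_top p B) \<and>
     topgroup_isomorphic (ME_group p B) (ME_top p B)
       (restrict_group Aff_group (RH_set p B)) (subtopology Aff_top (RH_set p B)) \<and>
     closed_subgroup (K_set p B) Sp_group Sp_top \<and>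
     topgroup_isomorphism (ME_group p B) (ME_top p B)
       (restrict_group Sp_group (K_set p B)) (subtopology Sp_top (K_set p B))
       (\<lambda>(m, a). K_mat m a) \<and>
     closed_subgroup (RH_set p B) Aff_group Aff_top \<and>
     (\<exists>K. closed_subgroup K (Sp_group :: (real^((1 + 'n) + (1 + 'n))^((1 + 'n) + (1 + 'n))) monoid) Sp_top \<and>
        topgroup_isomorphic (G_group p B) G_top
          (restrict_group Sp_group K) (subtopology Sp_top K)) \<and>
     (\<exists>K. closed_subgroup K (Aff_group :: ((real^(1 + 'n)) \<times> (real^(1 + 'n)^(1 + 'n))) monoid) Aff_top \<and>
        topgroup_isomorphic (G_group p B) G_top
          (restrict_group Aff_group K) (subtopology Aff_top K))"
proof -
  have dir: "no_bounded_direction p B"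
    by (rule no_bounded_direction_if_not_similar_skew[OF M1 M2])
  note G = topological_group_G[OF comm, of p]
  \<comment> \<open>All three isomorphisms start at \<open>G_group p B\<close>; the two between matrix groups are obtained by
    cancelling \<open>G_to_ME p B\<close>.\<close>
  have carrier_G: "carrier (G_group p B) = UNIV" by (simp add: G_group_def)
  have ME: "topgroup_isomorphism (G_group p B) G_top (ME_group p B) (ME_top p B) (G_to_ME p B)"
  proof (rule topgroup_isomorphism_transport[OF G])
    show "homeomorphic_map euclidean (ME_top p B) (G_to_ME p B)"
      using homeomorphic_G_to_ME[OF comm dir] by simp
    show "topspace (ME_top p B) = carrier (ME_group p B)"
      by (simp add: ME_group_def semidirect_def additive_group_def restrict_group_def)
    show "G_to_ME p B \<one>\<^bsub>G_group p B\<^esub> = \<one>\<^bsub>ME_group p B\<^esub>"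
      by (simp add: G_to_ME_def ME_group_def G_group_def semidirect_def additive_group_def
          restrict_group_def GL_group_def m_mat_0 a_mat_0)
  qed (rule G_to_ME_mult[OF comm])
  have im_RH: "G_to_RH p B ` carrier (G_group p B) = RH_set p B"
    and im_K: "G_to_K p B ` carrier (G_group p B) = K_set p B"
    by (simp_all only: carrier_G range_G_to_RH range_G_to_K)
  note RH = topgroup_isomorphism_closed_image[OF G topological_group_Aff
      closed_embedding_G_to_RH(1)[OF comm dir] im_RH
      closed_embedding_G_to_RH(2)[OF comm dir] G_to_RH_mult[OF comm]]
  note K = topgroup_isomorphism_closed_image[OF G topological_group_Sp
      closed_embedding_G_to_K(1)[OF comm dir] im_K
      closed_embedding_G_to_K(2)[OF comm dir] G_to_K_mult[OF comm]]
  have "topgroup_isomorphism (ME_group p B) (ME_top p B)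
      (restrict_group Sp_group (K_set p B)) (subtopology Sp_top (K_set p B)) (\<lambda>(m, a). K_mat m a)"
    by (rule topgroup_isomorphism_cancel[OF ME K(2)])
      (auto simp: G_to_ME_def G_to_K_def)
  moreover have "topgroup_isomorphism (ME_group p B) (ME_top p B)
      (restrict_group Aff_group (RH_set p B)) (subtopology Aff_top (RH_set p B))
      (G_to_RH p B \<circ> inv_into UNIV (G_to_ME p B))"
  proof (rule topgroup_isomorphism_cancel[OF ME RH(2)])
    have "inj (G_to_ME p B)"
      using ME by (simp add: topgroup_isomorphism_def iso_def bij_betw_def carrier_G)
    then show "(G_to_RH p B \<circ> inv_into UNIV (G_to_ME p B)) (G_to_ME p B g) = G_to_RH p B g" for g
      by simp
  qed
  ultimately show ?thesis
    using ME RH K unfolding topgroup_isomorphic_def by blast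
qed

end
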